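(* Let $p\in(0,1)$ be fixed (independent of $n$). For almost all graphs $G$ in the Erdős–Rényi model $G_{n,p}$, the energy of the second multiple Zagreb matrix $\ln\prod_2(G)$ satisfies $$\mathscr{E}\Big(\ln\prod\nolimits_2(G)\Big)=(1+o(1))\frac{16}{3\pi}\sqrt{p(1-p)}\cdot n^{3/2}\ln n.$$
   Context: $G_{n,p}$ is the model of random simple graphs on vertex set $\{1,\dots,n\}$ in which each edge is present independently with probability $p$; $d_i$ is the degree of vertex $i$ in $G=(V,E)$. $\ln\prod_2(G)$ is the name of the $n\times n$ matrix with $(i,j)$-entry $\ln d_i+\ln d_j$ if $ij\in E$ and $0$ otherwise. The energy of a real symmetric matrix $A$ with eigenvalues $\lambda_1,\dots,\lambda_n$ is $\mathscr{E}(A)=\sum_{i=1}^n|\lambda_i|$. "Almost all" means with probability tending to $1$ as $n\to\infty$; thus "for almost all graphs, $\mathscr{E}=(1+o(1))g(n)$" means that for every $\varepsilon>0$, $\Pr(|\mathscr{E}/g(n)-1|>\varepsilon)\to0$ as $n\to\infty$. *)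

theory Defs
  imports "HOL-Probability.Product_PMF" "Jordan_Normal_Form.Char_Poly"
begin

text \<open>
  A simple graph on the vertex set \<open>{1..n}\<close> is represented by its set of edges, each edge being a
  two-element set of vertices.
\<close>

definition possible_edges :: "nat \<Rightarrow> nat set set" where
  "possible_edges n = {e. e \<subseteq> {1..n} \<and> card e = 2}"

definition gnp :: "nat \<Rightarrow> real \<Rightarrow> nat set set pmf" where
  "gnp n p = map_pmf (\<lambda>f. {e \<in> possible_edges n. f e})
                     (Pi_pmf (possible_edges n) False (\<lambda>_. bernoulli_pmf p))"

definition degree_of :: "nat set set \<Rightarrow> nat \<Rightarrow> nat" where
  "degree_of E v = card {e \<in> E. v \<in> e}"

text \<open>
  Matrix indices start at \<open>0\<close>, so row and column \<open>i\<close> belong to the vertex \<open>Suc i\<close>.  The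
  diagonal vanishes because a singleton is never an edge, and the logarithms are only taken at
  endpoints of edges, where the degree is positive.
\<close>

definition ln_prod2_matrix :: "nat \<Rightarrow> nat set set \<Rightarrow> real mat" where
  "ln_prod2_matrix n E = mat n n (\<lambda>(i, j).
     if {Suc i, Suc j} \<in> E
     then ln (real (degree_of E (Suc i))) + ln (real (degree_of E (Suc j)))
     else 0)"

lemma transpose_ln_prod2_matrix: "transpose_mat (ln_prod2_matrix n E) = ln_prod2_matrix n E"
  by (rule eq_matI) (auto simp: ln_prod2_matrix_def insert_commute)

text \<open>
  The eigenvalues are taken with multiplicity, as the real roots of the characteristic polynomial.
  This is the whole spectrum for a symmetric real matrix, the only case for which the notion is
  intended.
\<close>

definition energy :: "real mat \<Rightarrow> real" where
  "energy A = (\<Sum>x\<in>#proots (char_poly A). \<bar>x\<bar>)"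

end

theory Submission
  imports Defs "HOL-Real_Asymp.Real_Asymp"
begin

text \<open>
  The degrees of \<open>G\<^bsub>n,p\<^esub>\<close> are close to \<open>n p\<close>, so \<open>ln d\<^sub>i + ln d\<^sub>j\<close> is \<open>2 ln n\<close> up to terms
  that stay bounded in mean square, and the energy is \<open>2 ln n\<close> times the energy of the adjacency matrix
  up to a negligible error.  Replacing the adjacency matrix by the matrix \<open>X\<close> of centered edge
  indicators subtracts \<open>p\<close> times a matrix of energy at most \<open>2 n\<close>.  What remains is
  a semicircle law for \<open>X\<close>: its energy is about \<open>n\<^sup>3\<^sup>/\<^sup>2\<close> times the first absolute moment
  \<open>8 \<sigma> / (3 \<pi>)\<close> of the semicircle distribution of variance \<open>\<sigma>\<^sup>2 = p (1 - p)\<close>.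

  All comparisons of energies rest on one fact: the energy of a symmetric matrix is the largest value of
  \<open>tr (W A)\<close> over orthogonal \<open>W\<close> (\<open>trace_orthogonal_le_energy\<close>, \<open>energy_eq_trace_orthogonal\<close>).
  Hence \<open>\<bar>energy A - energy B\<bar>\<close> is at most the largest value of \<open>\<bar>tr (W (A - B))\<bar>\<close>,
  which is bounded in three cases: for
  \<open>A - B\<close> small in Frobenius norm, for \<open>A - B\<close> constant off a zero diagonal, and for a change of a
  single edge.  The last bound gives concentration: a function of independent edges that changes by at
  most \<open>c\<close> when one edge is switched has variance at most \<open>n\<^sup>2 c\<^sup>2\<close> (\<open>bounded_differences_variance\<close>),
  so the energy of \<open>X\<close> has variance \<open>O(n\<^sup>2)\<close>, against a squared mean of order \<open>n\<^sup>3\<close>.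

  The mean energy is found without counting closed walks.  Since \<open>\<integral>\<^sub>0\<^sup>\<infinity> x\<^sup>2 / (x\<^sup>2 + y\<^sup>2) dy\<close> equals
  \<open>\<bar>x\<bar> \<pi> / 2\<close>, the energy is an integral over \<open>y > 0\<close> of an affine function of the imaginary part
  of the trace of the resolvent \<open>(X - \<i> y \<surd>n)\<^sup>-\<^sup>1\<close>.  For one centered edge indicator \<open>\<xi>\<close> the mean of \<open>\<xi> F\<close> is exactly
  \<open>p (1 - p)\<close> times the mean of \<open>F(edge present) - F(edge absent)\<close>.  Applied to the entries of the resolvent, and
  combined with the resolvent identity and the concentration of the trace, this shows that
  \<open>s = mean (tr (X - \<i> y \<surd>n)\<^sup>-\<^sup>1) / \<surd>n\<close> satisfies \<open>1 + \<i> y s + p (1 - p) s\<^sup>2 = o(1)\<close>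
  (\<open>loop_equation\<close>).  The quadratic has one root in the upper half plane, and \<open>s\<close> converges to it
  (\<open>quadratic_stability\<close>); dominated convergence passes the limit through the integral over
  \<open>y\<close> (\<open>mean_energy_centered\<close>).
\<close>

section \<open>The spectral theorem for real symmetric matrices\<close>

definition dotp :: "nat \<Rightarrow> (nat \<Rightarrow> real) \<Rightarrow> (nat \<Rightarrow> real) \<Rightarrow> real" where
  "dotp n x y = (\<Sum>i<n. x i * y i)"

definition mat_vec :: "nat \<Rightarrow> (nat \<Rightarrow> nat \<Rightarrow> real) \<Rightarrow> (nat \<Rightarrow> real) \<Rightarrow> nat \<Rightarrow> real" where
  "mat_vec n a x i = (\<Sum>j<n. a i j * x j)"

lemma dotp_commute: "dotp n x y = dotp n y x"
  by (simp add: dotp_def mult.commute)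

lemma dotp_lin:
  "dotp n (\<lambda>i. x i + y i) z = dotp n x z + dotp n y z"
  "dotp n (\<lambda>i. x i - y i) z = dotp n x z - dotp n y z"
  "dotp n (\<lambda>i. c * x i) z = c * dotp n x z"
  "dotp n z (\<lambda>i. x i + y i) = dotp n z x + dotp n z y"
  "dotp n z (\<lambda>i. x i - y i) = dotp n z x - dotp n z y"
  "dotp n z (\<lambda>i. c * x i) = c * dotp n z x"
  by (simp_all add: dotp_def algebra_simps sum.distrib sum_subtractf sum_distrib_left)

lemma mat_vec_lin:
  "mat_vec n a (\<lambda>i. x i + y i) = (\<lambda>i. mat_vec n a x i + mat_vec n a y i)"
  "mat_vec n a (\<lambda>i. c * x i) = (\<lambda>i. c * mat_vec n a x i)"
  by (rule ext, simp add: mat_vec_def algebra_simps sum.distrib sum_distrib_left)+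

lemma dotp_self_nonneg: "0 \<le> dotp n x x"
  by (simp add: dotp_def sum_nonneg)

lemma dotp_self_eq_0: "dotp n x x = 0 \<Longrightarrow> i < n \<Longrightarrow> x i = 0"
  by (simp add: dotp_def sum_nonneg_eq_0_iff)

lemma dotp_mat_vec_symmetric:
  assumes "\<And>i j. i < n \<Longrightarrow> j < n \<Longrightarrow> a i j = a j i"
  shows "dotp n (mat_vec n a x) y = dotp n x (mat_vec n a y)"
proof -
  have "dotp n (mat_vec n a x) y = (\<Sum>i<n. \<Sum>j<n. a i j * x j * y i)"
    by (simp add: dotp_def mat_vec_def sum_distrib_right)
  also have "\<dots> = (\<Sum>j<n. \<Sum>i<n. a i j * x j * y i)"
    by (rule sum.swap)
  also have "\<dots> = (\<Sum>j<n. \<Sum>i<n. a j i * x j * y i)"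
    by (intro sum.cong) (auto simp: assms)
  also have "\<dots> = dotp n x (mat_vec n a y)"
    by (simp add: dotp_def mat_vec_def sum_distrib_left mult_ac)
  finally show ?thesis .
qed

text \<open>
  First-order optimality: a linear term dominated by a quadratic one for all \<open>t\<close>, positive and negative,
  has slope \<open>0\<close>.
\<close>

lemma linear_le_quadratic_imp_0:
  fixes \<beta> \<gamma> :: real
  assumes "\<And>t. t * \<beta> \<le> t\<^sup>2 * \<gamma>"
  shows "\<beta> = 0"
proof (rule ccontr)
  assume "\<beta> \<noteq> 0"
  \<comment> \<open>This t has the sign of \<beta> and is so small that the quadratic term loses.\<close>
  define t where "t = \<beta> / (\<bar>\<gamma>\<bar> + 1)"
  have "t * \<beta> = \<beta>\<^sup>2 / (\<bar>\<gamma>\<bar> + 1)" by (simp add: t_def power2_eq_square)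
  moreover have "t\<^sup>2 * \<gamma> \<le> t\<^sup>2 * \<bar>\<gamma>\<bar>" by (intro mult_left_mono) auto
  moreover have "t\<^sup>2 * \<bar>\<gamma>\<bar> = \<beta>\<^sup>2 / (\<bar>\<gamma>\<bar> + 1) * (\<bar>\<gamma>\<bar> / (\<bar>\<gamma>\<bar> + 1))"
    by (simp add: t_def power2_eq_square)
  moreover have "\<beta>\<^sup>2 / (\<bar>\<gamma>\<bar> + 1) * (\<bar>\<gamma>\<bar> / (\<bar>\<gamma>\<bar> + 1)) < \<beta>\<^sup>2 / (\<bar>\<gamma>\<bar> + 1) * 1"
    using \<open>\<beta> \<noteq> 0\<close> by (intro mult_strict_left_mono) (auto simp: divide_simps)
  ultimately show False using assms[of t] by linarith
qed

text \<open>
  Project the standard basis vectors onto the complement of the span.  The squared lengths of the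
  projections sum to \<open>n - k\<close>, the trace of the projection, so one of them is nonzero and can be normalized.
\<close>

lemma exists_unit_vector_orthogonal:
  assumes on: "\<And>r s. r < k \<Longrightarrow> s < k \<Longrightarrow> dotp n (u r) (u s) = (if r = s then 1 else 0)"
    and "k < n"
  shows "\<exists>x. dotp n x x = 1 \<and> (\<forall>r<k. dotp n x (u r) = 0)"
proof -
  define e :: "nat \<Rightarrow> nat \<Rightarrow> real" where "e = (\<lambda>m i. if i = m then 1 else 0)"
  define w where "w = (\<lambda>m i. e m i - (\<Sum>r<k. u r m * u r i))"
  have e: "dotp n (e m) x = x m" if "m < n" for m x
    using that by (simp add: dotp_def e_def if_distrib[of "\<lambda>c. c * _"] sum.delta' cong: if_cong)
  have sum_right: "dotp n x (\<lambda>i. \<Sum>r<k. c r * u r i) = (\<Sum>r<k. c r * dotp n x (u r))" for c x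
    unfolding dotp_def sum_distrib_left by (subst sum.swap) (simp add: mult_ac)
  have wu: "dotp n (w m) (u s) = 0" if "m < n" "s < k" for m s
  proof -
    have "dotp n (w m) (u s) = dotp n (e m) (u s) - (\<Sum>r<k. u r m * dotp n (u s) (u r))"
      unfolding w_def dotp_lin by (subst (2) dotp_commute) (simp add: sum_right)
    also have "(\<Sum>r<k. u r m * dotp n (u s) (u r)) = (\<Sum>r<k. if r = s then u r m else 0)"
      using that on by (intro sum.cong) auto
    also have "\<dots> = u s m" using that by simp
    finally show ?thesis using e[OF \<open>m < n\<close>] by simp
  qed
  have ww: "dotp n (w m) (w m) = 1 - (\<Sum>r<k. (u r m)\<^sup>2)" if "m < n" for m
  proof -
    have "dotp n (w m) (w m) = dotp n (w m) (e m) - (\<Sum>r<k. u r m * dotp n (w m) (u r))"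
      by (subst (2) w_def) (simp add: dotp_lin sum_right)
    also have "\<dots> = w m m"
      using wu[OF that] e[OF that, of "w m"] by (simp add: dotp_commute)
    finally show ?thesis by (simp add: w_def e_def power2_eq_square)
  qed
  have "\<exists>m<n. dotp n (w m) (w m) \<noteq> 0"
  proof (rule ccontr)
    assume "\<not> ?thesis"
    hence "(\<Sum>m<n. dotp n (w m) (w m)) = 0" by simp
    also have "(\<Sum>m<n. dotp n (w m) (w m)) = real n - (\<Sum>m<n. \<Sum>r<k. (u r m)\<^sup>2)"
      by (simp add: ww sum_subtractf)
    also have "(\<Sum>m<n. \<Sum>r<k. (u r m)\<^sup>2) = (\<Sum>r<k. dotp n (u r) (u r))"
      by (subst sum.swap) (simp add: dotp_def power2_eq_square)
    also have "\<dots> = real k" using on by simp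
    finally show False using \<open>k < n\<close> by simp
  qed
  then obtain m where m: "m < n" "dotp n (w m) (w m) \<noteq> 0" by blast
  define c where "c = 1 / sqrt (dotp n (w m) (w m))"
  have "c * (c * dotp n (w m) (w m)) = 1"
    using m dotp_self_nonneg[of n "w m"] by (simp add: c_def field_simps)
  hence "dotp n (\<lambda>i. c * w m i) (\<lambda>i. c * w m i) = 1" by (simp add: dotp_lin)
  moreover have "\<forall>r<k. dotp n (\<lambda>i. c * w m i) (u r) = 0"
    using wu m by (simp add: dotp_lin)
  ultimately show ?thesis by blast
qed

text \<open>
  The quadratic form of \<open>a\<close> attains its maximum \<open>c\<close> on the unit sphere of the complement of the
  eigenvectors found so far.  At a maximizer \<open>v\<close> the residual \<open>z = a v - c v\<close> is orthogonal to those
  eigenvectors, because \<open>a\<close> is symmetric, so \<open>v + t z\<close> stays in the complement, and optimality in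
  the direction \<open>z\<close> gives \<open>z \<bullet> z = 0\<close>.
\<close>

lemma exists_next_eigenvector:
  assumes sym: "\<And>i j. i < n \<Longrightarrow> j < n \<Longrightarrow> a i j = a j i"
    and on: "\<And>r s. r < k \<Longrightarrow> s < k \<Longrightarrow> dotp n (u r) (u s) = (if r = s then 1 else 0)"
    and eig: "\<And>r i. r < k \<Longrightarrow> i < n \<Longrightarrow> mat_vec n a (u r) i = d r * u r i"
    and "k < n"
  shows "\<exists>v c. dotp n v v = 1 \<and> (\<forall>r<k. dotp n v (u r) = 0) \<and> (\<forall>i<n. mat_vec n a v i = c * v i)"
proof -
  \<comment> \<open>Vectors are functions on all of the naturals; fixing the value 0 beyond n makes the box compact.\<close>
  define B :: "(nat \<Rightarrow> real) set" where
    "B = PiE UNIV (\<lambda>i. if i < n then {-1..1} else {0})"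
  define K where "K = B \<inter> {x. dotp n x x = 1 \<and> (\<forall>r<k. dotp n x (u r) = 0)}"
  have "compactin (product_topology (\<lambda>_. euclidean) UNIV) B"
    unfolding B_def by (subst compactin_PiE) auto
  hence "compact B" by (simp add: euclidean_product_topology)
  moreover have coord [continuous_intros]: "continuous_on UNIV (\<lambda>x::nat \<Rightarrow> real. x i)" for i
    by (rule continuous_on_product_coordinates)
  have cdot: "continuous_on UNIV (\<lambda>x. dotp n x (f x))"
    if "\<And>i. continuous_on UNIV (\<lambda>x. f x i)" for f
    unfolding dotp_def by (intro continuous_intros that)
  have "closed {x. dotp n x x = 1 \<and> (\<forall>r<k. dotp n x (u r) = 0)}"
    by (intro closed_Collect_conj closed_Collect_all closed_Collect_imp closed_Collect_eq cdot
        continuous_intros) auto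
  ultimately have "compact K" unfolding K_def by (rule compact_Int_closed)
  have restrict: "dotp n (\<lambda>i. if i < n then x i else 0) y = dotp n x y" for x y
    unfolding dotp_def by (intro sum.cong) auto
  have inK: "(\<lambda>i. if i < n then x i else 0) \<in> K"
    if "dotp n x x = 1" "\<forall>r<k. dotp n x (u r) = 0" for x
  proof -
    have "\<bar>x i\<bar> \<le> 1" if "i < n" for i
    proof -
      have "(x i)\<^sup>2 \<le> dotp n x x"
        unfolding dotp_def power2_eq_square
        using that by (intro member_le_sum) auto
      thus ?thesis using \<open>dotp n x x = 1\<close> by (simp add: abs_square_le_1)
    qed
    hence "(\<lambda>i. if i < n then x i else 0) \<in> B" by (auto simp: B_def abs_le_iff minus_le_iff)
    moreover have "dotp n (\<lambda>i. if i < n then x i else 0) (\<lambda>i. if i < n then x i else 0) = 1"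
      using that(1) restrict[of x x] restrict[of x "\<lambda>i. if i < n then x i else 0"]
        dotp_commute[of n x "\<lambda>i. if i < n then x i else 0"] by linarith
    ultimately show ?thesis using that by (simp add: K_def restrict)
  qed
  have "K \<noteq> {}"
    using exists_unit_vector_orthogonal[of k n u] on \<open>k < n\<close> inK by blast
  define q where "q = (\<lambda>x. dotp n x (mat_vec n a x))"
  have "continuous_on K q"
    unfolding q_def mat_vec_def
    by (rule continuous_on_subset[OF cdot]) (auto intro!: continuous_intros)
  from continuous_attains_sup[OF \<open>compact K\<close> \<open>K \<noteq> {}\<close> this]
  obtain v where v: "v \<in> K" and max: "\<And>x. x \<in> K \<Longrightarrow> q x \<le> q v" by blast
  have vv: "dotp n v v = 1" and vu: "\<And>r. r < k \<Longrightarrow> dotp n v (u r) = 0"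
    using v by (auto simp: K_def)
  define c where "c = q v"
  have qbound: "q x \<le> c * dotp n x x" if "\<forall>r<k. dotp n x (u r) = 0" for x
  proof (cases "dotp n x x = 0")
    case True
    have "q x = 0" unfolding q_def dotp_def using dotp_self_eq_0[OF True] by simp
    thus ?thesis using True by simp
  next
    case False
    define s where "s = sqrt (dotp n x x)"
    have s: "s > 0" "s * s = dotp n x x"
      using False dotp_self_nonneg[of n x] by (auto simp: s_def)
    define y where "y = (\<lambda>i. inverse s * x i)"
    have "dotp n y y = inverse s * (inverse s * (s * s))"
      by (simp only: y_def dotp_lin s(2))
    hence "dotp n y y = 1" using s(1) by (simp add: field_simps)
    moreover have "\<forall>r<k. dotp n y (u r) = 0" using that by (simp add: y_def dotp_lin)
    ultimately have "q (\<lambda>i. if i < n then y i else 0) \<le> c" using inK max c_def by blast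
    moreover have "q (\<lambda>i. if i < n then y i else 0) = q y"
      unfolding q_def restrict unfolding dotp_def mat_vec_def by (intro sum.cong) auto
    moreover have "q y = inverse (s * s) * q x"
      by (simp add: q_def y_def mat_vec_lin dotp_lin)
    moreover have "dotp n x x > 0" using s by (metis mult_pos_pos)
    ultimately show ?thesis using s by (simp add: field_simps)
  qed
  define z where "z = (\<lambda>i. mat_vec n a v i - c * v i)"
  have zu: "dotp n z (u r) = 0" if "r < k" for r
  proof -
    have "dotp n (mat_vec n a v) (u r) = dotp n v (mat_vec n a (u r))"
      using sym by (rule dotp_mat_vec_symmetric)
    also have "\<dots> = dotp n v (\<lambda>i. d r * u r i)"
      unfolding dotp_def using eig that by (intro sum.cong) auto
    also have "\<dots> = 0" using vu that by (simp add: dotp_lin)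
    finally show ?thesis using vu that by (simp add: z_def dotp_lin)
  qed
  have "t * (2 * dotp n z z) \<le> t\<^sup>2 * (c * dotp n z z - q z)" for t
  proof -
    have "q (\<lambda>i. v i + t * z i) \<le> c * dotp n (\<lambda>i. v i + t * z i) (\<lambda>i. v i + t * z i)"
      using vu zu by (intro qbound) (simp add: dotp_lin)
    moreover have "q (\<lambda>i. v i + t * z i) = q v + 2 * t * dotp n (mat_vec n a v) z + t\<^sup>2 * q z"
    proof -
      have "dotp n v (mat_vec n a z) = dotp n (mat_vec n a v) z"
        by (rule dotp_mat_vec_symmetric[symmetric]) (rule sym)
      thus ?thesis
        by (simp add: q_def mat_vec_lin dotp_lin dotp_commute[of n z "mat_vec n a v"] algebra_simps
            power2_eq_square)
    qed
    moreover have "dotp n (\<lambda>i. v i + t * z i) (\<lambda>i. v i + t * z i)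
        = 1 + 2 * t * dotp n v z + t\<^sup>2 * dotp n z z"
      using vv by (simp add: dotp_lin dotp_commute[of n z v] algebra_simps power2_eq_square)
    moreover have "dotp n z z = dotp n (mat_vec n a v) z - c * dotp n v z"
      by (subst (1) z_def) (simp add: dotp_lin)
    ultimately have "c + 2 * t * (dotp n z z + c * dotp n v z) + t\<^sup>2 * q z
        \<le> c * (1 + 2 * t * dotp n v z + t\<^sup>2 * dotp n z z)"
      by (simp add: c_def)
    thus ?thesis by (simp add: algebra_simps)
  qed
  from linear_le_quadratic_imp_0[OF this] have "dotp n z z = 0" by simp
  hence "\<forall>i<n. mat_vec n a v i = c * v i" using dotp_self_eq_0[of n z] by (auto simp: z_def)
  thus ?thesis using vv vu by blast
qed

text \<open>
  The eigenvectors are the rows \<open>u k\<close>.  Orthonormality of the rows makes products of functions of the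
  matrix computable; orthonormality of the columns says that the constant function \<open>1\<close> gives the identity.
\<close>

definition spectral_decomp ::
    "nat \<Rightarrow> (nat \<Rightarrow> nat \<Rightarrow> real) \<Rightarrow> (nat \<Rightarrow> nat \<Rightarrow> real) \<Rightarrow> (nat \<Rightarrow> real) \<Rightarrow> bool" where
  "spectral_decomp n a u d \<longleftrightarrow>
     (\<forall>k<n. \<forall>l<n. (\<Sum>i<n. u k i * u l i) = (if k = l then 1 else 0)) \<and>
     (\<forall>i<n. \<forall>j<n. (\<Sum>k<n. u k i * u k j) = (if i = j then 1 else 0)) \<and>
     (\<forall>i<n. \<forall>j<n. a i j = (\<Sum>k<n. d k * (u k i * u k j)))"

lemma orthonormal_rows_imp_columns:
  fixes u :: "nat \<Rightarrow> nat \<Rightarrow> real"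
  assumes "\<And>k l. k < n \<Longrightarrow> l < n \<Longrightarrow> (\<Sum>i<n. u k i * u l i) = (if k = l then 1 else 0)"
    and "i < n" "j < n"
  shows "(\<Sum>k<n. u k i * u k j) = (if i = j then 1 else 0)"
proof -
  define U where "U = mat n n (\<lambda>(k, i). u k i)"
  have U: "U \<in> carrier_mat n n" by (simp add: U_def)
  have "U * transpose_mat U = 1\<^sub>m n"
    using assms(1) by (intro eq_matI) (auto simp: U_def scalar_prod_def lessThan_atLeast0)
  hence "transpose_mat U * U = 1\<^sub>m n"
    using mat_mult_left_right_inverse[of U n "transpose_mat U"] U by simp
  hence "(transpose_mat U * U) $$ (i, j) = 1\<^sub>m n $$ (i, j)" by simp
  thus ?thesis using assms(2,3) by (simp add: U_def scalar_prod_def lessThan_atLeast0)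
qed

theorem spectral_theorem:
  assumes sym: "\<And>i j. i < n \<Longrightarrow> j < n \<Longrightarrow> a i j = a j i"
  shows "\<exists>u d. spectral_decomp n a u d"
proof -
  have "\<exists>u d. (\<forall>r<k. \<forall>s<k. dotp n (u r) (u s) = (if r = s then 1 else 0)) \<and>
              (\<forall>r<k. \<forall>i<n. mat_vec n a (u r) i = d r * u r i)" if "k \<le> n" for k
    using that
  proof (induction k)
    case 0
    thus ?case by simp
  next
    case (Suc k)
    have "k \<le> n" using Suc.prems by simp
    from Suc.IH[OF this] obtain u d where
      "\<forall>r<k. \<forall>s<k. dotp n (u r) (u s) = (if r = s then 1 else 0)"
      "\<forall>r<k. \<forall>i<n. mat_vec n a (u r) i = d r * u r i"
      by (elim exE conjE)
    hence on: "\<And>r s. r < k \<Longrightarrow> s < k \<Longrightarrow> dotp n (u r) (u s) = (if r = s then 1 else 0)"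
      and eig: "\<And>r i. r < k \<Longrightarrow> i < n \<Longrightarrow> mat_vec n a (u r) i = d r * u r i"
      by blast+
    have "\<exists>v c. dotp n v v = 1 \<and> (\<forall>r<k. dotp n v (u r) = 0) \<and> (\<forall>i<n. mat_vec n a v i = c * v i)"
      by (rule exists_next_eigenvector[of n a k u d]) (use sym on eig Suc.prems in auto)
    then obtain v c where
      v: "dotp n v v = 1" "\<forall>r<k. dotp n v (u r) = 0" "\<forall>i<n. mat_vec n a v i = c * v i" by blast
    have v': "\<forall>r<k. dotp n (u r) v = 0" using v(2) by (simp add: dotp_commute)
    show ?case
      by (rule exI[of _ "u(k := v)"], rule exI[of _ "d(k := c)"])
        (use on eig v v' in \<open>auto simp: less_Suc_eq\<close>)
  qed
  from this[OF order_refl] obtain u d where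
    ud: "\<forall>r<n. \<forall>s<n. dotp n (u r) (u s) = (if r = s then 1 else 0)"
    "\<forall>r<n. \<forall>i<n. mat_vec n a (u r) i = d r * u r i"
    by (elim exE conjE)
  hence on: "\<And>k l. k < n \<Longrightarrow> l < n \<Longrightarrow> (\<Sum>i<n. u k i * u l i) = (if k = l then 1 else 0)"
    and eig: "\<And>r i. r < n \<Longrightarrow> i < n \<Longrightarrow> (\<Sum>l<n. a i l * u r l) = d r * u r i"
    unfolding dotp_def mat_vec_def by blast+
  have col: "(\<Sum>k<n. u k i * u k j) = (if i = j then 1 else 0)" if "i < n" "j < n" for i j
    by (rule orthonormal_rows_imp_columns) (use on that in auto)
  have "a i j = (\<Sum>k<n. d k * (u k i * u k j))" if "i < n" "j < n" for i j
  proof -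
    have "a i j = (\<Sum>l<n. if l = j then a i l else 0)" using that by simp
    also have "\<dots> = (\<Sum>l<n. a i l * (\<Sum>k<n. u k l * u k j))"
      using that by (intro sum.cong) (auto simp: col)
    also have "\<dots> = (\<Sum>l<n. \<Sum>k<n. a i l * u k l * u k j)"
      by (simp add: sum_distrib_left mult.assoc)
    also have "\<dots> = (\<Sum>k<n. (\<Sum>l<n. a i l * u k l) * u k j)"
      by (subst sum.swap) (simp add: sum_distrib_right)
    also have "\<dots> = (\<Sum>k<n. d k * (u k i * u k j))"
      using that by (intro sum.cong) (auto simp: eig)
    finally show ?thesis .
  qed
  thus ?thesis using on col unfolding spectral_decomp_def by blast
qed

text \<open>
  An orthogonal change of basis makes the matrix similar to a diagonal one, and similar matrices
  have the same characteristic polynomial.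
\<close>

lemma energy_spectral_decomp:
  assumes "spectral_decomp n a u d"
  shows "energy (mat n n (\<lambda>(i, j). a i j)) = (\<Sum>k<n. \<bar>d k\<bar>)"
proof -
  define A where "A = mat n n (\<lambda>(i, j). a i j)"
  define D where "D = mat n n (\<lambda>(k, l). if k = l then d k else 0)"
  define U where "U = mat n n (\<lambda>(k, i). u k i)"
  have [simp]: "A \<in> carrier_mat n n" "D \<in> carrier_mat n n" "U \<in> carrier_mat n n"
    by (auto simp: A_def D_def U_def)
  have UU: "U * transpose_mat U = 1\<^sub>m n" and UU': "transpose_mat U * U = 1\<^sub>m n"
    using assms unfolding spectral_decomp_def
    by (auto intro!: eq_matI simp: U_def scalar_prod_def lessThan_atLeast0)
  have DU: "D * U = mat n n (\<lambda>(k, i). d k * u k i)"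
    by (intro eq_matI)
      (auto simp: D_def U_def scalar_prod_def if_distrib[of "\<lambda>c. c * _"] sum.delta' cong: if_cong)
  have "A = transpose_mat U * (D * U)"
    unfolding DU using assms unfolding spectral_decomp_def
    by (intro eq_matI) (auto simp: U_def A_def scalar_prod_def lessThan_atLeast0 mult_ac)
  also have "\<dots> = transpose_mat U * D * U"
    by (rule assoc_mult_mat[symmetric, of _ n n _ n _ n]) auto
  finally have ADU: "A = transpose_mat U * D * U" .
  have "{A, D, transpose_mat U, U} \<subseteq> carrier_mat n n" by simp
  hence "similar_mat A D"
    using UU' UU ADU by (rule similar_matI)
  hence "char_poly A = char_poly D" by (rule char_poly_similar)
  also have "\<dots> = (\<Prod>x\<leftarrow>diag_mat D. [:- x, 1:])"
    by (rule char_poly_upper_triangular[of _ n]) (auto simp: D_def)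
  also have "diag_mat D = map d [0..<n]"
    by (auto simp: diag_mat_def D_def)
  finally have cp: "char_poly A = (\<Prod>k\<leftarrow>[0..<n]. [:- d k, 1:])" by (simp add: o_def)
  have "proots (\<Prod>k\<leftarrow>[0..<n]. [:- d k, 1:]) = mset (map d [0..<n])"
    for n
  proof (induction n)
    case (Suc n)
    have "(\<Prod>k\<leftarrow>[0..<n]. [:- d k, 1:]) \<noteq> 0" by (auto simp: prod_list_zero_iff)
    with Suc show ?case by (simp add: proots_mult del: proots_linear_factor mult_pCons_right) simp
  qed simp
  hence "energy A = sum_mset (mset (map (\<lambda>k. \<bar>d k\<bar>) [0..<n]))"
    by (simp add: energy_def cp image_mset.compositionality o_def flip: mset_map)
  also have "\<dots> = (\<Sum>k<n. \<bar>d k\<bar>)"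
    by (subst sum_mset_sum_list) (simp add: sum_list_distinct_conv_sum_set lessThan_atLeast0)
  finally show ?thesis by (simp add: A_def)
qed

section \<open>Functional calculus\<close>

text \<open>
  A matrix is an entry function, of which only the entries with both indices below \<open>n\<close> matter.
\<close>

definition symmetric_on :: "nat \<Rightarrow> (nat \<Rightarrow> nat \<Rightarrow> real) \<Rightarrow> bool" where
  "symmetric_on n a \<longleftrightarrow> (\<forall>i<n. \<forall>j<n. a i j = a j i)"

definition eigenbasis :: "nat \<Rightarrow> (nat \<Rightarrow> nat \<Rightarrow> real) \<Rightarrow> (nat \<Rightarrow> nat \<Rightarrow> real) \<times> (nat \<Rightarrow> real)" where
  "eigenbasis n a = (SOME ud. spectral_decomp n a (fst ud) (snd ud))"

abbreviation "eigvec n a \<equiv> fst (eigenbasis n a)"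
abbreviation "eigval n a \<equiv> snd (eigenbasis n a)"

lemma spectral_decomp_eigenbasis:
  assumes "symmetric_on n a"
  shows "spectral_decomp n a (eigvec n a) (eigval n a)"
proof -
  have "\<exists>u d. spectral_decomp n a u d"
    by (rule spectral_theorem) (use assms in \<open>auto simp: symmetric_on_def\<close>)
  then obtain u d where "spectral_decomp n a u d" by blast
  hence "\<exists>ud. spectral_decomp n a (fst ud) (snd ud)" by (intro exI[of _ "(u, d)"]) simp
  thus ?thesis unfolding eigenbasis_def
    by (rule someI_ex[of "\<lambda>ud. spectral_decomp n a (fst ud) (snd ud)"])
qed

definition fun_energy :: "nat \<Rightarrow> (nat \<Rightarrow> nat \<Rightarrow> real) \<Rightarrow> real" where
  "fun_energy n a = (\<Sum>k<n. \<bar>eigval n a k\<bar>)"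

lemma energy_eq_fun_energy:
  assumes "symmetric_on n a"
  shows "energy (mat n n (\<lambda>(i, j). a i j)) = fun_energy n a"
  unfolding fun_energy_def by (rule energy_spectral_decomp[OF spectral_decomp_eigenbasis[OF assms]])

text \<open>
  The matrix \<open>f(a)\<close>.  The target is an arbitrary normed field because the sign of \<open>a\<close> is needed over
  the reals and the resolvent of \<open>a\<close> over the complex numbers.
\<close>

definition matrix_fun ::
    "nat \<Rightarrow> (nat \<Rightarrow> nat \<Rightarrow> real) \<Rightarrow> (real \<Rightarrow> 'b) \<Rightarrow> nat \<Rightarrow> nat \<Rightarrow> 'b :: real_normed_field" where
  "matrix_fun n a f i j = (\<Sum>k<n. f (eigval n a k) * of_real (eigvec n a k i * eigvec n a k j))"

lemma matrix_fun_commute: "matrix_fun n a f i j = matrix_fun n a f j i"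
  by (simp add: matrix_fun_def mult_ac)

lemma eigvec_orthonormal:
  assumes "symmetric_on n a" "k < n" "l < n"
  shows "(\<Sum>i<n. eigvec n a k i * eigvec n a l i) = (if k = l then 1 else 0)"
  using spectral_decomp_eigenbasis[OF assms(1)] assms(2,3) unfolding spectral_decomp_def by blast

lemma matrix_fun_id:
  assumes "symmetric_on n a" "i < n" "j < n"
  shows "matrix_fun n a of_real i j = of_real (a i j)"
  using spectral_decomp_eigenbasis[OF assms(1)] assms(2,3)
  unfolding spectral_decomp_def matrix_fun_def by simp

lemma matrix_fun_1:
  assumes "symmetric_on n a" "i < n" "j < n"
  shows "matrix_fun n a (\<lambda>_. 1) i j = (if i = j then 1 else 0 :: 'b :: real_normed_field)"
proof -
  have "(\<Sum>k<n. eigvec n a k i * eigvec n a k j) = (if i = j then 1 else 0)"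
    using spectral_decomp_eigenbasis[OF assms(1)] assms(2,3) unfolding spectral_decomp_def by blast
  hence "of_real (\<Sum>k<n. eigvec n a k i * eigvec n a k j) = (if i = j then 1 else 0 :: 'b)" by simp
  thus ?thesis by (simp add: matrix_fun_def)
qed

lemma matrix_fun_add:
  "matrix_fun n a (\<lambda>x. f x + g x) i j = matrix_fun n a f i j + matrix_fun n a g i j"
  by (simp add: matrix_fun_def algebra_simps sum.distrib)

lemma matrix_fun_cmult:
  "matrix_fun n a (\<lambda>x. c * f x) i j = c * matrix_fun n a f i j"
  by (simp add: matrix_fun_def mult.assoc sum_distrib_left)

lemma sum_rotate:
  "(\<Sum>i\<in>A. \<Sum>j\<in>B. \<Sum>k\<in>C. f i j k) = (\<Sum>k\<in>C. \<Sum>i\<in>A. \<Sum>j\<in>B. f i j k)"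
proof -
  have "(\<Sum>i\<in>A. \<Sum>j\<in>B. \<Sum>k\<in>C. f i j k) = (\<Sum>i\<in>A. \<Sum>k\<in>C. \<Sum>j\<in>B. f i j k)"
    by (intro sum.cong refl) (rule sum.swap)
  also have "\<dots> = (\<Sum>k\<in>C. \<Sum>i\<in>A. \<Sum>j\<in>B. f i j k)" by (rule sum.swap)
  finally show ?thesis .
qed

lemma matrix_fun_mult:
  assumes a: "symmetric_on n a"
  shows "(\<Sum>j<n. matrix_fun n a f i j * matrix_fun n a g j l) = matrix_fun n a (\<lambda>x. f x * g x) i l"
proof -
  define u where "u = eigvec n a"
  define d where "d = eigval n a"
  have "(\<Sum>j<n. matrix_fun n a f i j * matrix_fun n a g j l)
      = (\<Sum>j<n. \<Sum>k<n. \<Sum>m<n. f (d k) * of_real (u k i * u k j) * (g (d m) * of_real (u m j * u m l)))"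
    unfolding matrix_fun_def sum_product u_def d_def ..
  also have "\<dots> = (\<Sum>k<n. \<Sum>m<n. \<Sum>j<n. f (d k) * of_real (u k i * u k j) * (g (d m) * of_real (u m j * u m l)))"
    by (rule sum_rotate[symmetric])
  also have "\<dots> = (\<Sum>k<n. \<Sum>m<n. f (d k) * g (d m) * of_real (u k i * u m l * (\<Sum>j<n. u k j * u m j)))"
    unfolding sum_distrib_left of_real_sum by (intro sum.cong refl) simp
  also have "\<dots> = (\<Sum>k<n. \<Sum>m<n. if m = k then f (d k) * g (d k) * of_real (u k i * u k l) else 0)"
    by (intro sum.cong refl) (auto simp: u_def eigvec_orthonormal[OF a])
  also have "\<dots> = matrix_fun n a (\<lambda>x. f x * g x) i l"
    by (simp add: matrix_fun_def u_def d_def)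
  finally show ?thesis .
qed

lemma trace_matrix_fun:
  assumes a: "symmetric_on n a"
  shows "(\<Sum>i<n. matrix_fun n a f i i) = (\<Sum>k<n. f (eigval n a k))"
proof -
  have "(\<Sum>i<n. matrix_fun n a f i i)
      = (\<Sum>k<n. f (eigval n a k) * of_real (\<Sum>i<n. eigvec n a k i * eigvec n a k i))"
    unfolding matrix_fun_def by (subst sum.swap) (simp add: sum_distrib_left)
  also have "\<dots> = (\<Sum>k<n. f (eigval n a k))"
    by (intro sum.cong refl) (subst eigvec_orthonormal[OF a], auto)
  finally show ?thesis .
qed

lemma sum_eigval_squares:
  assumes a: "symmetric_on n a"
  shows "(\<Sum>k<n. (eigval n a k)\<^sup>2) = (\<Sum>i<n. \<Sum>j<n. (a i j)\<^sup>2)"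
proof -
  have "(\<Sum>k<n. (eigval n a k)\<^sup>2) = (\<Sum>i<n. matrix_fun n a (\<lambda>x. x * x) i i)"
    by (simp add: trace_matrix_fun[OF a] power2_eq_square)
  also have "\<dots> = (\<Sum>i<n. \<Sum>j<n. matrix_fun n a (\<lambda>x. x) i j * matrix_fun n a (\<lambda>x. x) j i)"
    by (simp add: matrix_fun_mult[OF a])
  also have "\<dots> = (\<Sum>i<n. \<Sum>j<n. (a i j)\<^sup>2)"
    using matrix_fun_id[OF a, where ?'a = real] a
    by (intro sum.cong refl) (simp add: power2_eq_square symmetric_on_def id_def)
  finally show ?thesis .
qed

section \<open>Energy as a maximum over orthogonal matrices\<close>

definition orthogonal_on :: "nat \<Rightarrow> (nat \<Rightarrow> nat \<Rightarrow> real) \<Rightarrow> bool" where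
  "orthogonal_on n w \<longleftrightarrow> (\<forall>i<n. \<forall>j<n. (\<Sum>k<n. w i k * w j k) = (if i = j then 1 else 0))"

lemma abs_orthogonal_entry_le_1:
  assumes w: "orthogonal_on n w" and "i < n" "j < n"
  shows "\<bar>w i j\<bar> \<le> 1"
proof -
  have "(w i j)\<^sup>2 \<le> (\<Sum>k<n. (w i k)\<^sup>2)" using assms by (intro member_le_sum) auto
  also have "\<dots> = 1" using assms by (simp add: orthogonal_on_def power2_eq_square)
  finally show ?thesis by (simp add: abs_square_le_1)
qed

text \<open>
  An orthogonal matrix preserves Euclidean length; the arithmetic-geometric mean inequality then
  bounds the bilinear form without square roots.
\<close>

lemma orthogonal_on_bilinear:
  assumes w: "orthogonal_on n w"
  shows "2 * \<bar>\<Sum>i<n. \<Sum>j<n. x i * w i j * y j\<bar> \<le> (\<Sum>i<n. (x i)\<^sup>2) + (\<Sum>j<n. (y j)\<^sup>2)"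
proof -
  define z where "z = (\<lambda>j. \<Sum>i<n. x i * w i j)"
  have "(\<Sum>j<n. (z j)\<^sup>2) = (\<Sum>j<n. \<Sum>i<n. \<Sum>k<n. x i * x k * (w i j * w k j))"
    unfolding z_def power2_eq_square sum_product by (intro sum.cong refl) simp
  also have "\<dots> = (\<Sum>i<n. \<Sum>k<n. x i * x k * (\<Sum>j<n. w i j * w k j))"
    unfolding sum_distrib_left by (rule sum_rotate[symmetric])
  also have "\<dots> = (\<Sum>i<n. \<Sum>k<n. if k = i then x i * x i else 0)"
    using w by (intro sum.cong refl) (auto simp: orthogonal_on_def)
  finally have z: "(\<Sum>j<n. (z j)\<^sup>2) = (\<Sum>i<n. (x i)\<^sup>2)" by (simp add: power2_eq_square)
  have "(\<Sum>i<n. \<Sum>j<n. x i * w i j * y j) = (\<Sum>j<n. z j * y j)"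
    unfolding z_def by (subst sum.swap) (simp add: sum_distrib_right)
  also have "2 * \<bar>\<dots>\<bar> \<le> (\<Sum>j<n. 2 * \<bar>z j * y j\<bar>)"
    using sum_abs[of "\<lambda>j. z j * y j" "{..<n}"] by (simp flip: sum_distrib_left)
  also have "\<dots> \<le> (\<Sum>j<n. (z j)\<^sup>2 + (y j)\<^sup>2)"
  proof (rule sum_mono)
    fix j
    have "0 \<le> (\<bar>z j\<bar> - \<bar>y j\<bar>)\<^sup>2" by simp
    thus "2 * \<bar>z j * y j\<bar> \<le> (z j)\<^sup>2 + (y j)\<^sup>2"
      unfolding power2_diff by (simp add: abs_mult)
  qed
  finally show ?thesis by (simp add: sum.distrib z)
qed

text \<open>
  In an eigenbasis the trace is a combination of the eigenvalues with the coefficients \<open>u\<^sub>k \<bullet> W u\<^sub>k\<close>,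
  each of absolute value at most \<open>1\<close>.
\<close>

lemma trace_orthogonal_le_energy:
  assumes a: "symmetric_on n a" and w: "orthogonal_on n w"
  shows "(\<Sum>i<n. \<Sum>j<n. w i j * a i j) \<le> fun_energy n a"
proof -
  define u where "u = eigvec n a"
  define d where "d = eigval n a"
  have "(\<Sum>i<n. \<Sum>j<n. w i j * a i j) = (\<Sum>i<n. \<Sum>j<n. \<Sum>k<n. d k * (u k i * w i j * u k j))"
    using spectral_decomp_eigenbasis[OF a]
    by (intro sum.cong refl) (simp add: spectral_decomp_def u_def d_def sum_distrib_left mult_ac)
  also have "\<dots> = (\<Sum>k<n. d k * (\<Sum>i<n. \<Sum>j<n. u k i * w i j * u k j))"
    unfolding sum_distrib_left by (rule sum_rotate)
  also have "\<dots> \<le> (\<Sum>k<n. \<bar>d k\<bar>)"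
  proof (rule sum_mono)
    fix k assume "k \<in> {..<n}"
    hence "(\<Sum>i<n. (u k i)\<^sup>2) = 1"
      using eigvec_orthonormal[OF a, of k k] by (simp add: u_def power2_eq_square)
    with orthogonal_on_bilinear[OF w, of "u k" "u k"]
    have "\<bar>\<Sum>i<n. \<Sum>j<n. u k i * w i j * u k j\<bar> \<le> 1" by simp
    hence "\<bar>d k * (\<Sum>i<n. \<Sum>j<n. u k i * w i j * u k j)\<bar> \<le> \<bar>d k\<bar>"
      unfolding abs_mult by (intro mult_left_le) auto
    thus "d k * (\<Sum>i<n. \<Sum>j<n. u k i * w i j * u k j) \<le> \<bar>d k\<bar>" by linarith
  qed
  finally show ?thesis by (simp add: fun_energy_def d_def)
qed

text \<open>
  The maximum is attained at the sign of the matrix.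
\<close>

lemma energy_eq_trace_orthogonal:
  assumes a: "symmetric_on n a"
  obtains w where "orthogonal_on n w" "fun_energy n a = (\<Sum>i<n. \<Sum>j<n. w i j * a i j)"
proof -
  \<comment> \<open>The value at 0 must be a unit as well, or the matrix would fail to be orthogonal when a is singular.\<close>
  define s where "s = (\<lambda>x::real. if x \<ge> 0 then 1 else - 1 :: real)"
  define w where "w = matrix_fun n a s"
  have ss: "(\<lambda>x. s x * s x) = (\<lambda>_. 1)" by (auto simp: s_def)
  have "(\<Sum>k<n. w i k * w j k) = (if i = j then 1 else 0)" if "i < n" "j < n" for i j
    using matrix_fun_mult[OF a, of s i s j] matrix_fun_1[OF a that, where ?'b = real]
    unfolding w_def by (subst matrix_fun_commute[of _ _ _ j]) (simp add: ss)
  hence "orthogonal_on n w" by (simp add: orthogonal_on_def)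
  moreover have "(\<Sum>i<n. \<Sum>j<n. w i j * a i j) = (\<Sum>i<n. \<Sum>j<n. w i j * matrix_fun n a of_real j i)"
    using a matrix_fun_id[OF a, where ?'a = real] 
    by (intro sum.cong refl) (simp add: symmetric_on_def)
  moreover have "\<dots> = (\<Sum>k<n. s (eigval n a k) * eigval n a k)"
    unfolding w_def by (simp add: matrix_fun_mult[OF a] trace_matrix_fun[OF a])
  moreover have "\<dots> = fun_energy n a"
    unfolding fun_energy_def by (intro sum.cong) (auto simp: s_def)
  ultimately show ?thesis using that by simp
qed

text \<open>
  A trace against a maximizer for one matrix is a lower bound for the energy of the other.
\<close>

lemma energy_diff_le:
  assumes a: "symmetric_on n a" and b: "symmetric_on n b"
    and C: "\<And>w. orthogonal_on n w \<Longrightarrow> \<bar>\<Sum>i<n. \<Sum>j<n. w i j * (a i j - b i j)\<bar> \<le> C"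
  shows "\<bar>fun_energy n a - fun_energy n b\<bar> \<le> C"
proof -
  obtain w where w: "orthogonal_on n w" "fun_energy n a = (\<Sum>i<n. \<Sum>j<n. w i j * a i j)"
    using energy_eq_trace_orthogonal[OF a] .
  obtain v where v: "orthogonal_on n v" "fun_energy n b = (\<Sum>i<n. \<Sum>j<n. v i j * b i j)"
    using energy_eq_trace_orthogonal[OF b] .
  show ?thesis
    using C[OF w(1)] C[OF v(1)] w(2) v(2)
      trace_orthogonal_le_energy[OF a v(1)] trace_orthogonal_le_energy[OF b w(1)]
    by (simp add: right_diff_distrib sum_subtractf)
qed

lemma sum_squares_orthogonal:
  assumes "orthogonal_on n w"
  shows "(\<Sum>i<n. \<Sum>j<n. (w i j)\<^sup>2) = real n"
  using assms by (simp add: orthogonal_on_def power2_eq_square)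

lemma energy_diff_le_frobenius:
  assumes a: "symmetric_on n a" and b: "symmetric_on n b"
  shows "\<bar>fun_energy n a - fun_energy n b\<bar> \<le> sqrt (real n * (\<Sum>i<n. \<Sum>j<n. (a i j - b i j)\<^sup>2))"
proof (rule energy_diff_le[OF a b])
  fix w assume w: "orthogonal_on n w"
  have "(\<Sum>i<n. \<Sum>j<n. w i j * (a i j - b i j))\<^sup>2
      \<le> (\<Sum>i<n. \<Sum>j<n. (w i j)\<^sup>2) * (\<Sum>i<n. \<Sum>j<n. (a i j - b i j)\<^sup>2)"
    unfolding sum.cartesian_product
    using Cauchy_Schwarz_ineq_sum[of "\<lambda>(i, j). w i j" "\<lambda>(i, j). a i j - b i j" "{..<n} \<times> {..<n}"]
    by (simp add: case_prod_beta)
  thus "\<bar>\<Sum>i<n. \<Sum>j<n. w i j * (a i j - b i j)\<bar>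
      \<le> sqrt (real n * (\<Sum>i<n. \<Sum>j<n. (a i j - b i j)\<^sup>2))"
    unfolding sum_squares_orthogonal[OF w] by (intro real_le_rsqrt) simp
qed

lemma energy_cmult:
  assumes a: "symmetric_on n a" and "c \<ge> 0"
  shows "fun_energy n (\<lambda>i j. c * a i j) = c * fun_energy n a"
proof (rule antisym)
  have ca: "symmetric_on n (\<lambda>i j. c * a i j)" using a by (simp add: symmetric_on_def)
  obtain w where w: "orthogonal_on n w" "fun_energy n a = (\<Sum>i<n. \<Sum>j<n. w i j * a i j)"
    using energy_eq_trace_orthogonal[OF a] .
  obtain v where v: "orthogonal_on n v"
    "fun_energy n (\<lambda>i j. c * a i j) = (\<Sum>i<n. \<Sum>j<n. v i j * (c * a i j))"
    using energy_eq_trace_orthogonal[OF ca] .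
  have pull: "(\<Sum>i<n. \<Sum>j<n. z i j * (c * a i j)) = c * (\<Sum>i<n. \<Sum>j<n. z i j * a i j)" for z
    by (simp add: sum_distrib_left mult_ac)
  show "fun_energy n (\<lambda>i j. c * a i j) \<le> c * fun_energy n a"
    using v(2) trace_orthogonal_le_energy[OF a v(1)] \<open>c \<ge> 0\<close> unfolding pull
    by (simp add: mult_left_mono)
  show "c * fun_energy n a \<le> fun_energy n (\<lambda>i j. c * a i j)"
    using w(2) trace_orthogonal_le_energy[OF ca w(1)] unfolding pull by simp
qed

section \<open>The resolvent on the imaginary axis\<close>

text \<open>
  The inverse of \<open>a - \<i> \<eta>\<close>.  As the spectrum of \<open>a\<close> is real, its operator norm is at most \<open>1 / \<eta>\<close>
  for every symmetric \<open>a\<close>, so the bounds on its entries hold for each graph and not only for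
  typical ones.
\<close>

definition resolvent :: "nat \<Rightarrow> (nat \<Rightarrow> nat \<Rightarrow> real) \<Rightarrow> real \<Rightarrow> nat \<Rightarrow> nat \<Rightarrow> complex" where
  "resolvent n a \<eta> = matrix_fun n a (\<lambda>x. 1 / (of_real x - \<i> * of_real \<eta>))"

lemma of_real_diff_imaginary_nonzero: "\<eta> > 0 \<Longrightarrow> of_real x - \<i> * of_real \<eta> \<noteq> 0"
  by (auto simp: complex_eq_iff)

lemma resolvent_commute: "resolvent n a \<eta> i j = resolvent n a \<eta> j i"
  unfolding resolvent_def by (rule matrix_fun_commute)

lemma mult_resolvent:
  assumes a: "symmetric_on n a" and "\<eta> > 0" and "i < n" "l < n"
  shows "(\<Sum>j<n. of_real (a i j) * resolvent n a \<eta> j l)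
      = (if i = l then 1 else 0) + \<i> * of_real \<eta> * resolvent n a \<eta> i l"
proof -
  have "(\<Sum>j<n. of_real (a i j) * resolvent n a \<eta> j l)
      = (\<Sum>j<n. matrix_fun n a of_real i j * resolvent n a \<eta> j l)"
    by (intro sum.cong refl) (simp add: matrix_fun_id[OF a] assms)
  also have "\<dots> = matrix_fun n a (\<lambda>x. of_real x * (1 / (of_real x - \<i> * of_real \<eta>))) i l"
    unfolding resolvent_def by (rule matrix_fun_mult[OF a])
  also have "(\<lambda>x. of_real x * (1 / (of_real x - \<i> * of_real \<eta>)))
      = (\<lambda>x. 1 + \<i> * of_real \<eta> * (1 / (of_real x - \<i> * of_real \<eta>)))"
    using of_real_diff_imaginary_nonzero[OF \<open>\<eta> > 0\<close>] by (auto simp: field_simps)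
  finally show ?thesis
    by (simp only: matrix_fun_add matrix_fun_cmult matrix_fun_1[OF assms(1,3,4)] resolvent_def)
qed

text \<open>
  Insert \<open>(b - \<i> \<eta>) - (a - \<i> \<eta>)\<close> between the two resolvents.
\<close>

lemma resolvent_identity:
  assumes a: "symmetric_on n a" and b: "symmetric_on n b" and "\<eta> > 0" and "i < n" "l < n"
  shows "resolvent n a \<eta> i l - resolvent n b \<eta> i l
      = (\<Sum>j<n. \<Sum>k<n. resolvent n a \<eta> i j * of_real (b j k - a j k) * resolvent n b \<eta> k l)"
proof -
  define A where "A = resolvent n a \<eta>"
  define B where "B = resolvent n b \<eta>"
  have Aa: "(\<Sum>j<n. A i j * of_real (a j k)) = (if i = k then 1 else 0) + \<i> * of_real \<eta> * A i k"
    if "k < n" for k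
  proof -
    have "(\<Sum>j<n. A i j * of_real (a j k)) = (\<Sum>j<n. of_real (a k j) * resolvent n a \<eta> j i)"
      using a that resolvent_commute[of n a \<eta> i]
      by (intro sum.cong refl) (simp add: A_def symmetric_on_def mult.commute)
    thus ?thesis
      using mult_resolvent[OF a \<open>\<eta> > 0\<close> that \<open>i < n\<close>] resolvent_commute[of n a \<eta> i k]
      by (simp add: A_def)
  qed
  have "(\<Sum>j<n. \<Sum>k<n. A i j * of_real (b j k - a j k) * B k l)
      = (\<Sum>j<n. A i j * (\<Sum>k<n. of_real (b j k) * B k l))
        - (\<Sum>j<n. \<Sum>k<n. A i j * of_real (a j k) * B k l)"
    by (simp add: algebra_simps sum_subtractf sum_distrib_left)
  also have "(\<Sum>j<n. A i j * (\<Sum>k<n. of_real (b j k) * B k l))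
      = (\<Sum>j<n. (if j = l then A i j else 0) + \<i> * of_real \<eta> * (A i j * B j l))"
    by (intro sum.cong refl) (simp add: B_def mult_resolvent[OF b] assms algebra_simps)
  also have "\<dots> = A i l + \<i> * of_real \<eta> * (\<Sum>j<n. A i j * B j l)"
    using \<open>l < n\<close> by (simp add: sum.distrib sum_distrib_left)
  also have "(\<Sum>j<n. \<Sum>k<n. A i j * of_real (a j k) * B k l)
      = (\<Sum>k<n. (\<Sum>j<n. A i j * of_real (a j k)) * B k l)"
    by (subst sum.swap) (simp add: sum_distrib_right)
  also have "\<dots> = (\<Sum>k<n. (if k = i then B k l else 0) + \<i> * of_real \<eta> * (A i k * B k l))"
    by (intro sum.cong refl) (simp add: Aa algebra_simps)
  also have "\<dots> = B i l + \<i> * of_real \<eta> * (\<Sum>j<n. A i j * B j l)"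
    using \<open>i < n\<close> by (simp add: sum.distrib sum_distrib_left)
  finally show ?thesis by (simp add: A_def B_def)
qed

lemma cmod_diff_imaginary: "(cmod (of_real x - \<i> * of_real \<eta>))\<^sup>2 = x\<^sup>2 + \<eta>\<^sup>2"
  by (simp add: cmod_power2)

text \<open>
  Multiplying the resolvent by its adjoint gives the function \<open>1 / (x\<^sup>2 + \<eta>\<^sup>2)\<close> of the matrix; the sum is
  a diagonal entry of it.
\<close>

lemma sum_cmod_resolvent_row:
  assumes a: "symmetric_on n a" and "\<eta> > 0" and "i < n"
  shows "(\<Sum>j<n. (cmod (resolvent n a \<eta> i j))\<^sup>2) \<le> 1 / \<eta>\<^sup>2"
proof -
  let ?f = "\<lambda>x. 1 / (of_real x - \<i> * of_real \<eta>)"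
  have cnj: "cnj (resolvent n a \<eta> i j) = matrix_fun n a (\<lambda>x. cnj (?f x)) i j" for j
    by (simp add: resolvent_def matrix_fun_def)
  have sq: "?f x * cnj (?f x) = of_real (1 / (x\<^sup>2 + \<eta>\<^sup>2))" for x
    unfolding complex_norm_square[symmetric] by (simp add: norm_divide power_divide cmod_diff_imaginary)
  have "of_real (\<Sum>j<n. (cmod (resolvent n a \<eta> i j))\<^sup>2)
      = (\<Sum>j<n. resolvent n a \<eta> i j * matrix_fun n a (\<lambda>x. cnj (?f x)) j i)"
    by (simp only: of_real_sum complex_norm_square cnj matrix_fun_commute[of n a _ i])
  also have "\<dots> = matrix_fun n a (\<lambda>x. of_real (1 / (x\<^sup>2 + \<eta>\<^sup>2))) i i"
    unfolding resolvent_def matrix_fun_mult[OF a] sq ..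
  also have "\<dots> = of_real (\<Sum>k<n. 1 / ((eigval n a k)\<^sup>2 + \<eta>\<^sup>2) * (eigvec n a k i * eigvec n a k i))"
    by (simp add: matrix_fun_def)
  finally have "(\<Sum>j<n. (cmod (resolvent n a \<eta> i j))\<^sup>2)
      = (\<Sum>k<n. 1 / ((eigval n a k)\<^sup>2 + \<eta>\<^sup>2) * (eigvec n a k i * eigvec n a k i))"
    by (simp only: of_real_eq_iff)
  also have "\<dots> \<le> (\<Sum>k<n. 1 / \<eta>\<^sup>2 * (eigvec n a k i * eigvec n a k i))"
    using \<open>\<eta> > 0\<close> by (intro sum_mono mult_right_mono divide_left_mono) (auto intro!: mult_pos_pos add_nonneg_pos)
  also have "\<dots> = 1 / \<eta>\<^sup>2"
    using matrix_fun_1[OF a \<open>i < n\<close> \<open>i < n\<close>, where ?'b = real]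
    by (simp add: matrix_fun_def flip: sum_distrib_left sum_divide_distrib)
  finally show ?thesis .
qed

lemma cmod_resolvent_entry_le:
  assumes "symmetric_on n a" and "\<eta> > 0" and "i < n" "j < n"
  shows "cmod (resolvent n a \<eta> i j) \<le> 1 / \<eta>"
proof (rule power2_le_imp_le)
  have "(cmod (resolvent n a \<eta> i j))\<^sup>2 \<le> (\<Sum>j<n. (cmod (resolvent n a \<eta> i j))\<^sup>2)"
    using \<open>j < n\<close> by (intro member_le_sum) auto
  thus "(cmod (resolvent n a \<eta> i j))\<^sup>2 \<le> (1 / \<eta>)\<^sup>2"
    using sum_cmod_resolvent_row[OF assms(1-3)] by (simp add: power_divide)
qed (use assms in simp)

definition trace_resolvent :: "nat \<Rightarrow> (nat \<Rightarrow> nat \<Rightarrow> real) \<Rightarrow> real \<Rightarrow> complex" where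
  "trace_resolvent n a \<eta> = (\<Sum>i<n. resolvent n a \<eta> i i)"

lemma Im_trace_resolvent:
  assumes "symmetric_on n a"
  shows "Im (trace_resolvent n a \<eta>) = (\<Sum>k<n. \<eta> / ((eigval n a k)\<^sup>2 + \<eta>\<^sup>2))"
  unfolding trace_resolvent_def resolvent_def trace_matrix_fun[OF assms]
  by (simp add: Im_divide power2_eq_square)

lemma sum_single_edge:
  fixes f :: "nat \<Rightarrow> nat \<Rightarrow> 'b :: comm_ring_1"
  assumes "p < n" "q < n" "p \<noteq> q"
  shows "(\<Sum>j<n. \<Sum>k<n. f j k * (if {j, k} = {p, q} then 1 else 0)) = f p q + f q p"
proof -
  have "f j k * (if {j, k} = {p, q} then 1 else 0)
      = (if k = q then if j = p then f j k else 0 else 0) + (if k = p then if j = q then f j k else 0 else 0)" for j k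
    using assms(3) by (auto simp: doubleton_eq_iff)
  thus ?thesis using assms by (simp add: sum.distrib)
qed

section \<open>Random subsets with independent elements\<close>

definition random_subset :: "real \<Rightarrow> 'a set \<Rightarrow> 'a set pmf" where
  "random_subset p S = map_pmf (\<lambda>f. {e \<in> S. f e}) (Pi_pmf S False (\<lambda>_. bernoulli_pmf p))"

lemma gnp_eq_random_subset: "gnp n p = random_subset p (possible_edges n)"
  by (simp add: gnp_def random_subset_def)

lemma set_pmf_random_subset: "set_pmf (random_subset p S) \<subseteq> Pow S"
  by (auto simp: random_subset_def)

lemma finite_set_pmf_random_subset: "finite S \<Longrightarrow> finite (set_pmf (random_subset p S))"
  by (rule finite_subset[OF set_pmf_random_subset]) simp

lemma integrable_random_subset [simp]:
  fixes f :: "'a set \<Rightarrow> 'b :: {banach, second_countable_topology}"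
  shows "finite S \<Longrightarrow> integrable (measure_pmf (random_subset p S)) f"
  by (rule integrable_measure_pmf_finite) (rule finite_set_pmf_random_subset)

abbreviation subset_mean :: "real \<Rightarrow> 'a set \<Rightarrow> ('a set \<Rightarrow> 'b) \<Rightarrow> 'b :: {banach, second_countable_topology}" where
  "subset_mean p S f \<equiv> measure_pmf.expectation (random_subset p S) f"

lemma subset_mean_cong:
  assumes "\<And>T. T \<subseteq> S \<Longrightarrow> f T = g T"
  shows "subset_mean p S f = subset_mean p S g"
  using set_pmf_random_subset[of p S] assms
  by (intro integral_cong_AE) (auto simp: AE_measure_pmf_iff)

lemma subset_mean_mono:
  fixes f g :: "'a set \<Rightarrow> real"
  assumes "finite S" "\<And>T. T \<subseteq> S \<Longrightarrow> f T \<le> g T"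
  shows "subset_mean p S f \<le> subset_mean p S g"
  using set_pmf_random_subset[of p S] assms
  by (intro integral_mono_AE) (auto simp: AE_measure_pmf_iff)

lemma random_subset_empty: "random_subset p {} = return_pmf {}"
  by (simp add: random_subset_def)

lemma random_subset_insert:
  assumes "finite S" "e \<notin> S"
  shows "random_subset p (insert e S)
    = bind_pmf (bernoulli_pmf p) (\<lambda>b. map_pmf (\<lambda>T. if b then insert e T else T) (random_subset p S))"
proof -
  have *: "{x \<in> insert e S. (f(e := b)) x} = (if b then insert e {x \<in> S. f x} else {x \<in> S. f x})"
    for f b using assms by auto
  show ?thesis
    unfolding random_subset_def Pi_pmf_insert'[OF assms] map_bind_pmf map_pmf_comp map_return_pmf *
    by (simp add: map_pmf_def bind_assoc_pmf bind_return_pmf)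
qed

context
  fixes p :: real
  assumes p: "0 \<le> p" "p \<le> 1"
begin

lemma subset_mean_insert:
  fixes f :: "'a set \<Rightarrow> 'b :: {banach, second_countable_topology}"
  assumes "finite S" "e \<notin> S"
  shows "subset_mean p (insert e S) f
    = subset_mean p S (\<lambda>T. p *\<^sub>R f (insert e T) + (1 - p) *\<^sub>R f T)"
proof -
  have "subset_mean p (insert e S) f = p *\<^sub>R subset_mean p S (\<lambda>T. f (insert e T)) + (1 - p) *\<^sub>R subset_mean p S f"
    unfolding random_subset_insert[OF assms]
    by (subst pmf_expectation_bind[where A = UNIV])
      (auto simp: UNIV_bool p assms finite_set_pmf_random_subset)
  also have "\<dots> = subset_mean p S (\<lambda>T. p *\<^sub>R f (insert e T) + (1 - p) *\<^sub>R f T)"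
    using assms by simp
  finally show ?thesis .
qed

text \<open>
  The indicator of \<open>e\<close> is independent of the rest of the random set, so it may be drawn again.
\<close>

lemma subset_mean_resample:
  fixes f :: "'a set \<Rightarrow> 'b :: {banach, second_countable_topology}"
  assumes "finite S" "e \<in> S"
  shows "subset_mean p S f = subset_mean p S (\<lambda>T. p *\<^sub>R f (insert e T) + (1 - p) *\<^sub>R f (T - {e}))"
proof -
  define S' where "S' = S - {e}"
  have S: "S = insert e S'" "finite S'" "e \<notin> S'" using assms by (auto simp: S'_def)
  show ?thesis
    unfolding S(1) subset_mean_insert[OF S(2,3)]
  proof (rule subset_mean_cong)
    fix T assume "T \<subseteq> S'"
    hence "T - {e} = T" using S(3) by auto
    thus "p *\<^sub>R f (insert e T) + (1 - p) *\<^sub>R f T =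
         p *\<^sub>R (p *\<^sub>R f (insert e (insert e T)) + (1 - p) *\<^sub>R f (insert e T - {e})) +
         (1 - p) *\<^sub>R (p *\<^sub>R f (insert e T) + (1 - p) *\<^sub>R f (T - {e}))"
      by (simp add: insert_Diff_if algebra_simps flip: scaleR_add_left)
  qed
qed

text \<open>
  Integration by parts for a centered Bernoulli variable: it takes the value \<open>1 - p\<close> with probability
  \<open>p\<close> and \<open>- p\<close> with probability \<open>1 - p\<close>, so the two weights are \<open>p (1 - p)\<close> and its negative.
\<close>

lemma subset_mean_centered_mult:
  fixes f :: "'a set \<Rightarrow> 'b :: {banach, second_countable_topology}"
  assumes "finite S" "e \<in> S"
  shows "subset_mean p S (\<lambda>T. ((if e \<in> T then 1 else 0) - p) *\<^sub>R f T)
    = (p * (1 - p)) *\<^sub>R subset_mean p S (\<lambda>T. f (insert e T) - f (T - {e}))"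
proof -
  have "subset_mean p S (\<lambda>T. ((if e \<in> T then 1 else 0) - p) *\<^sub>R f T)
      = subset_mean p S (\<lambda>T. (p * (1 - p)) *\<^sub>R (f (insert e T) - f (T - {e})))"
    by (subst subset_mean_resample[OF assms]) (simp add: algebra_simps)
  thus ?thesis by simp
qed

lemma subset_mean_indicator:
  assumes "finite S" "e \<in> S"
  shows "subset_mean p S (\<lambda>T. if e \<in> T then 1 else 0) = p"
  by (subst subset_mean_resample[OF assms]) simp

text \<open>
  The second moment of a two-valued variable, split into its squared mean and its variance.
\<close>

lemma convex_combination_norm_square:
  fixes a b :: "'b :: real_inner"
  shows "p * (norm a)\<^sup>2 + (1 - p) * (norm b)\<^sup>2
    = (norm (p *\<^sub>R a + (1 - p) *\<^sub>R b))\<^sup>2 + p * (1 - p) * (norm (a - b))\<^sup>2"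
  by (simp add: power2_norm_eq_inner inner_simps inner_commute algebra_simps)

text \<open>
  Averaging over one coordinate splits the variance into that of the averaged function, which
  inherits the difference bounds for the other coordinates, and a mean conditional variance of at most
  \<open>p (1 - p) c\<^sup>2\<close>.  The target is an inner product space so that the complex trace of the resolvent is
  covered together with real quantities.
\<close>

lemma bounded_differences_variance:
  fixes f :: "'a set \<Rightarrow> 'b :: {real_inner, banach, second_countable_topology}"
  assumes "finite S" and diff: "\<And>e T. e \<in> S \<Longrightarrow> T \<subseteq> S - {e} \<Longrightarrow> norm (f (insert e T) - f T) \<le> c e"
  shows "subset_mean p S (\<lambda>T. (norm (f T - subset_mean p S f))\<^sup>2) \<le> (\<Sum>e\<in>S. (c e)\<^sup>2)"
  using assms
proof (induction S arbitrary: f rule: finite_induct)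
  case empty
  thus ?case by (simp add: random_subset_empty)
next
  case (insert e S)
  \<comment> \<open>The conditional mean of f given all elements but e.\<close>
  define g where "g = (\<lambda>T. p *\<^sub>R f (insert e T) + (1 - p) *\<^sub>R f T)"
  define m where "m = subset_mean p S g"
  have m: "subset_mean p (insert e S) f = m"
    unfolding m_def g_def by (rule subset_mean_insert) (use insert in auto)
  have bd: "norm (g (insert x T) - g T) \<le> c x" if "x \<in> S" "T \<subseteq> S - {x}" for x T
  proof -
    have "g (insert x T) - g T = p *\<^sub>R (f (insert x (insert e T)) - f (insert e T))
        + (1 - p) *\<^sub>R (f (insert x T) - f T)"
      by (simp add: g_def algebra_simps insert_commute)
    also have "norm \<dots> \<le> p * norm (f (insert x (insert e T)) - f (insert e T))
        + (1 - p) * norm (f (insert x T) - f T)"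
      using p by (intro order_trans[OF norm_triangle_ineq]) simp
    also have "\<dots> \<le> p * c x + (1 - p) * c x"
      using that insert.hyps p by (intro add_mono mult_left_mono insert.prems) auto
    finally show ?thesis by (simp add: algebra_simps)
  qed
  have "subset_mean p (insert e S) (\<lambda>T. (norm (f T - m))\<^sup>2)
      = subset_mean p S (\<lambda>T. p * (norm (f (insert e T) - m))\<^sup>2 + (1 - p) * (norm (f T - m))\<^sup>2)"
    using insert.hyps by (simp add: subset_mean_insert del: Bochner_Integration.integral_add)
  also have "\<dots> \<le> subset_mean p S (\<lambda>T. (norm (g T - m))\<^sup>2 + (c e)\<^sup>2)"
  proof (rule subset_mean_mono)
    fix T assume T: "T \<subseteq> S"
    have "p *\<^sub>R (f (insert e T) - m) + (1 - p) *\<^sub>R (f T - m) = g T - m"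
      by (simp add: g_def algebra_simps)
    moreover have "p * (1 - p) * (norm (f (insert e T) - m - (f T - m)))\<^sup>2 \<le> 1 * (c e)\<^sup>2"
      using T insert.hyps p
      by (intro mult_mono power_mono mult_le_one) (auto intro!: insert.prems)
    ultimately show "p * (norm (f (insert e T) - m))\<^sup>2 + (1 - p) * (norm (f T - m))\<^sup>2
        \<le> (norm (g T - m))\<^sup>2 + (c e)\<^sup>2"
      unfolding convex_combination_norm_square by simp
  qed (use insert in auto)
  also have "\<dots> \<le> (\<Sum>x\<in>insert e S. (c x)\<^sup>2)"
    using insert.IH[OF bd] insert.hyps by (simp add: m_def)
  finally show ?case by (simp add: m)
qed

end

section \<open>Switching a single edge\<close>

definition adj :: "nat set set \<Rightarrow> nat \<Rightarrow> nat \<Rightarrow> real" where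
  "adj E i j = (if {Suc i, Suc j} \<in> E then 1 else 0)"

text \<open>
  For \<open>G\<^bsub>n,p\<^esub>\<close> the entries above the diagonal are independent with mean \<open>0\<close> and variance \<open>p (1 - p)\<close>.
\<close>

definition centered :: "real \<Rightarrow> nat set set \<Rightarrow> nat \<Rightarrow> nat \<Rightarrow> real" where
  "centered p E i j = (if i = j then 0 else adj E i j - p)"

lemma symmetric_on_adj: "symmetric_on n (adj E)"
  by (simp add: symmetric_on_def adj_def insert_commute)

lemma symmetric_on_centered: "symmetric_on n (centered p E)"
  by (simp add: symmetric_on_def centered_def adj_def insert_commute)

lemma finite_possible_edges [simp]: "finite (possible_edges n)"
  by (rule finite_subset[of _ "Pow {1..n}"]) (auto simp: possible_edges_def)

lemma card_possible_edges: "card (possible_edges n) \<le> n\<^sup>2"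
proof -
  have "card (possible_edges n) = n choose 2"
    unfolding possible_edges_def using n_subsets[of "{1..n}" 2] by simp
  also have "\<dots> = n * (n - 1) div 2" by (rule choose_two)
  also have "\<dots> \<le> n * (n - 1)" by simp
  also have "\<dots> \<le> n\<^sup>2" by (simp add: power2_eq_square)
  finally show ?thesis .
qed

lemma edge_in_possible_edges: "i < n \<Longrightarrow> j < n \<Longrightarrow> i \<noteq> j \<Longrightarrow> {Suc i, Suc j} \<in> possible_edges n"
  by (auto simp: possible_edges_def card_insert_if)

lemma possible_edgeE:
  assumes "e \<in> possible_edges n"
  obtains i j where "i < n" "j < n" "i \<noteq> j" "e = {Suc i, Suc j}"
proof -
  from assms obtain x y where "e = {x, y}" "x \<noteq> y" "{x, y} \<subseteq> {1..n}"
    by (auto simp: possible_edges_def card_2_iff)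
  thus ?thesis by (intro that[of "x - 1" "y - 1"]) auto
qed

text \<open>
  The relation between a matrix \<open>a\<close> with the edge \<open>rs\<close> absent and the matrix \<open>b\<close> with it present.
  Centering cancels in the difference.
\<close>

definition differ_by_edge :: "nat \<Rightarrow> (nat \<Rightarrow> nat \<Rightarrow> real) \<Rightarrow> (nat \<Rightarrow> nat \<Rightarrow> real) \<Rightarrow> nat \<Rightarrow> nat \<Rightarrow> bool" where
  "differ_by_edge n a b r s \<longleftrightarrow> r < n \<and> s < n \<and> r \<noteq> s \<and>
     (\<forall>j<n. \<forall>k<n. b j k - a j k = (if {j, k} = {r, s} then 1 else 0))"

lemma differ_by_edge_centered:
  assumes "i < n" "j < n" "i \<noteq> j"
  shows "differ_by_edge n (centered p (E - {{Suc i, Suc j}})) (centered p (insert {Suc i, Suc j} E)) i j"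
  using assms by (auto simp: differ_by_edge_def centered_def adj_def doubleton_eq_iff)

lemma energy_differ_by_edge:
  assumes a: "symmetric_on n a" and b: "symmetric_on n b" and ab: "differ_by_edge n a b r s"
  shows "\<bar>fun_energy n b - fun_energy n a\<bar> \<le> 2"
proof (rule energy_diff_le[OF b a])
  fix w assume w: "orthogonal_on n w"
  have rs: "r < n" "s < n" "r \<noteq> s" using ab by (auto simp: differ_by_edge_def)
  have "(\<Sum>i<n. \<Sum>j<n. w i j * (b i j - a i j)) = (\<Sum>i<n. \<Sum>j<n. w i j * (if {i, j} = {r, s} then 1 else 0))"
    using ab by (intro sum.cong refl) (auto simp: differ_by_edge_def)
  moreover have "\<dots> = w r s + w s r" using rs by (rule sum_single_edge)
  ultimately show "\<bar>\<Sum>i<n. \<Sum>j<n. w i j * (b i j - a i j)\<bar> \<le> 2"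
    using abs_orthogonal_entry_le_1[OF w, of r s] abs_orthogonal_entry_le_1[OF w, of s r] rs by linarith
qed

context
  fixes n :: nat and a b :: "nat \<Rightarrow> nat \<Rightarrow> real" and r s :: nat and \<eta> :: real
  assumes a: "symmetric_on n a" and b: "symmetric_on n b"
    and ab: "differ_by_edge n a b r s" and \<eta>: "\<eta> > 0"
begin

lemma resolvent_differ_by_edge:
  assumes "i < n" "l < n"
  shows "resolvent n a \<eta> i l - resolvent n b \<eta> i l
    = resolvent n a \<eta> i r * resolvent n b \<eta> s l + resolvent n a \<eta> i s * resolvent n b \<eta> r l"
proof -
  have "resolvent n a \<eta> i l - resolvent n b \<eta> i l
      = (\<Sum>j<n. \<Sum>k<n. resolvent n a \<eta> i j * resolvent n b \<eta> k l * (if {j, k} = {r, s} then 1 else 0))"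
    unfolding resolvent_identity[OF a b \<eta> assms] using ab
    by (intro sum.cong refl) (auto simp: differ_by_edge_def)
  also have "\<dots> = resolvent n a \<eta> i r * resolvent n b \<eta> s l + resolvent n a \<eta> i s * resolvent n b \<eta> r l"
    using ab by (intro sum_single_edge) (auto simp: differ_by_edge_def)
  finally show ?thesis .
qed

lemma cmod_resolvent_differ_by_edge:
  assumes "i < n" "l < n"
  shows "cmod (resolvent n a \<eta> i l - resolvent n b \<eta> i l) \<le> 2 / \<eta>\<^sup>2"
proof -
  have rs: "r < n" "s < n" using ab by (auto simp: differ_by_edge_def)
  have prod: "cmod (x * y) \<le> 1 / \<eta> * (1 / \<eta>)" if "cmod x \<le> 1 / \<eta>" "cmod y \<le> 1 / \<eta>" for x y
    unfolding norm_mult using that \<eta> by (intro mult_mono) auto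
  have "cmod (resolvent n a \<eta> i l - resolvent n b \<eta> i l)
      \<le> 1 / \<eta> * (1 / \<eta>) + 1 / \<eta> * (1 / \<eta>)"
    unfolding resolvent_differ_by_edge[OF assms]
    by (intro order_trans[OF norm_triangle_ineq] add_mono prod cmod_resolvent_entry_le a b rs assms \<eta>)
  thus ?thesis by (simp add: power2_eq_square)
qed

text \<open>
  Bounding the trace entry by entry would lose a factor \<open>n\<close>.  The resolvent identity instead leaves two
  inner products of rows of resolvents, and these rows have length at most \<open>1 / \<eta>\<close>.
\<close>

lemma cmod_trace_resolvent_differ_by_edge:
  "cmod (trace_resolvent n a \<eta> - trace_resolvent n b \<eta>) \<le> 2 / \<eta>\<^sup>2"
proof -
  have rs: "r < n" "s < n" using ab by (auto simp: differ_by_edge_def)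
  have half: "cmod (x * y) \<le> ((cmod x)\<^sup>2 + (cmod y)\<^sup>2) / 2" for x y
    using sum_squares_bound[of "cmod x" "cmod y"] by (simp add: norm_mult)
  have bound: "cmod (\<Sum>i<n. resolvent n a \<eta> i u * resolvent n b \<eta> v i) \<le> 1 / \<eta>\<^sup>2"
    if "u < n" "v < n" for u v
  proof -
    have "cmod (\<Sum>i<n. resolvent n a \<eta> i u * resolvent n b \<eta> v i)
        \<le> (\<Sum>i<n. ((cmod (resolvent n a \<eta> u i))\<^sup>2 + (cmod (resolvent n b \<eta> v i))\<^sup>2) / 2)"
      by (intro order_trans[OF norm_sum] sum_mono) (subst resolvent_commute[of _ _ _ _ u], rule half)
    also have "\<dots> = ((\<Sum>i<n. (cmod (resolvent n a \<eta> u i))\<^sup>2) + (\<Sum>i<n. (cmod (resolvent n b \<eta> v i))\<^sup>2)) / 2"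
      by (simp add: sum.distrib flip: sum_divide_distrib)
    also have "\<dots> \<le> (1 / \<eta>\<^sup>2 + 1 / \<eta>\<^sup>2) / 2"
      by (intro divide_right_mono add_mono sum_cmod_resolvent_row a b \<eta> that) simp
    finally show ?thesis by simp
  qed
  have "trace_resolvent n a \<eta> - trace_resolvent n b \<eta>
      = (\<Sum>i<n. resolvent n a \<eta> i r * resolvent n b \<eta> s i) + (\<Sum>i<n. resolvent n a \<eta> i s * resolvent n b \<eta> r i)"
    by (simp add: trace_resolvent_def resolvent_differ_by_edge flip: sum_subtractf sum.distrib)
  also have "cmod \<dots> \<le> 1 / \<eta>\<^sup>2 + 1 / \<eta>\<^sup>2"
    by (intro order_trans[OF norm_triangle_ineq] add_mono bound rs)
  finally show ?thesis by simp
qed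

text \<open>
  By the resolvent identity the difference of the two resolvents is minus a sum of products of one entry of each.  One
  edge changes an entry by only \<open>2 / \<eta>\<^sup>2\<close>, so both factors may be taken from the same matrix \<open>c\<close>, the
  one that belongs to the actual graph.
\<close>

lemma resolvent_difference_error:
  assumes "c = a \<or> c = b"
  shows "cmod ((resolvent n b \<eta> s r - resolvent n a \<eta> s r)
      + ((resolvent n c \<eta> s r)\<^sup>2 + resolvent n c \<eta> s s * resolvent n c \<eta> r r)) \<le> 4 / \<eta>^3"
proof -
  have rs: "r < n" "s < n" using ab by (auto simp: differ_by_edge_def)
  let ?A = "resolvent n a \<eta>" and ?B = "resolvent n b \<eta>" and ?C = "resolvent n c \<eta>"
  have eq: "?B s r - ?A s r = - (?A s r * ?B s r + ?A s s * ?B r r)"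
    using resolvent_differ_by_edge[OF rs(2,1)] by (simp add: algebra_simps)
  have prod: "cmod (x * (?A i l - ?B i l)) \<le> 1 / \<eta> * (2 / \<eta>\<^sup>2)"
    if "cmod x \<le> 1 / \<eta>" "i < n" "l < n" for x i l
    unfolding norm_mult using \<eta> that
    by (intro mult_mono cmod_resolvent_differ_by_edge) auto
  have "cmod ((?B s r - ?A s r) + ((?C s r)\<^sup>2 + ?C s s * ?C r r))
      \<le> 1 / \<eta> * (2 / \<eta>\<^sup>2) + 1 / \<eta> * (2 / \<eta>\<^sup>2)"
    using assms
  proof
    assume "c = a"
    hence "(?B s r - ?A s r) + ((?C s r)\<^sup>2 + ?C s s * ?C r r)
        = ?A s r * (?A s r - ?B s r) + ?A s s * (?A r r - ?B r r)"
      unfolding eq by (simp add: power2_eq_square algebra_simps)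
    also have "cmod \<dots> \<le> 1 / \<eta> * (2 / \<eta>\<^sup>2) + 1 / \<eta> * (2 / \<eta>\<^sup>2)"
      using rs \<eta> by (intro order_trans[OF norm_triangle_ineq] add_mono prod cmod_resolvent_entry_le a)
    finally show ?thesis .
  next
    assume "c = b"
    hence "(?B s r - ?A s r) + ((?C s r)\<^sup>2 + ?C s s * ?C r r)
        = - (?B s r * (?A s r - ?B s r) + ?B r r * (?A s s - ?B s s))"
      unfolding eq by (simp add: power2_eq_square algebra_simps)
    also have "cmod \<dots> \<le> 1 / \<eta> * (2 / \<eta>\<^sup>2) + 1 / \<eta> * (2 / \<eta>\<^sup>2)"
      unfolding norm_minus_cancel
      using rs \<eta> by (intro order_trans[OF norm_triangle_ineq] add_mono prod cmod_resolvent_entry_le b)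
    finally show ?thesis .
  qed
  thus ?thesis by (simp add: power2_eq_square power3_eq_cube)
qed

end

section \<open>The self-consistent equation for the mean trace\<close>

context
  fixes p :: real
  assumes p: "0 < p" "p < 1"
begin

abbreviation graph_mean :: "nat \<Rightarrow> (nat set set \<Rightarrow> 'b) \<Rightarrow> 'b :: {banach, second_countable_topology}" where
  "graph_mean n \<equiv> subset_mean p (possible_edges n)"

lemma p_weak: "0 \<le> p" "p \<le> 1"
  using p by auto

lemma bounded_difference_centered:
  fixes F :: "(nat \<Rightarrow> nat \<Rightarrow> real) \<Rightarrow> 'b :: {real_inner, banach, second_countable_topology}"
  assumes F: "\<And>a b r s. symmetric_on n a \<Longrightarrow> symmetric_on n b \<Longrightarrow> differ_by_edge n a b r s \<Longrightarrow> norm (F b - F a) \<le> C"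
    and "0 \<le> C"
  shows "graph_mean n (\<lambda>E. (norm (F (centered p E) - graph_mean n (\<lambda>E. F (centered p E))))\<^sup>2) \<le> (real n)\<^sup>2 * C\<^sup>2"
proof -
  have "graph_mean n (\<lambda>E. (norm (F (centered p E) - graph_mean n (\<lambda>E. F (centered p E))))\<^sup>2)
      \<le> (\<Sum>e\<in>possible_edges n. C\<^sup>2)"
  proof (rule bounded_differences_variance[OF p_weak finite_possible_edges])
    fix e T assume "e \<in> possible_edges n" and T: "T \<subseteq> possible_edges n - {e}"
    then obtain i j where ij: "i < n" "j < n" "i \<noteq> j" "e = {Suc i, Suc j}" by (elim possible_edgeE)
    have "T - {e} = T" using T by auto
    with differ_by_edge_centered[OF ij(1-3), of p T] ij(4)
    have "differ_by_edge n (centered p T) (centered p (insert e T)) i j" by simp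
    thus "norm (F (centered p (insert e T)) - F (centered p T)) \<le> C"
      by (intro F symmetric_on_centered)
  qed
  also have "\<dots> \<le> real (n\<^sup>2) * C\<^sup>2"
    using card_possible_edges[of n] by (simp only: sum_constant) (intro mult_right_mono, auto simp del: of_nat_power)
  finally show ?thesis by simp
qed

text \<open>
  The trace of \<open>X G = 1 + \<i> \<eta> G\<close> expresses \<open>n + \<i> \<eta> tr G\<close> as the sum of the products \<open>X\<^sub>i\<^sub>j G\<^sub>j\<^sub>i\<close>.
  Integration by parts in each edge replaces the mean of such a product by
  \<open>- p (1 - p)\<close> times the mean of \<open>G\<^sub>j\<^sub>i\<^sup>2 + G\<^sub>j\<^sub>j G\<^sub>i\<^sub>i\<close>.  The second terms sum to \<open>(tr G)\<^sup>2\<close>, whose mean is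
  nearly the square of the mean because \<open>tr G\<close> has small variance; the first terms sum to at most
  \<open>n / \<eta>\<^sup>2\<close> by the bound on the rows.
  With \<open>\<eta> = y \<surd>n\<close> every error term is \<open>o(n)\<close>.
\<close>

lemma loop_equation:
  fixes n :: nat and \<eta> :: real
  assumes "\<eta> > 0"
  defines "G \<equiv> \<lambda>E. resolvent n (centered p E) \<eta>" and "T \<equiv> \<lambda>E. trace_resolvent n (centered p E) \<eta>"
  shows "cmod (of_nat n + \<i> * of_real \<eta> * graph_mean n T + of_real (p * (1 - p)) * (graph_mean n T)\<^sup>2)
      \<le> 4 * n\<^sup>2 / \<eta>^3 + 3 * n / \<eta>\<^sup>2 + 4 * n\<^sup>2 / \<eta>^4"
proof -
  define v where "v = p * (1 - p)"
  have v: "0 \<le> v" "v \<le> 1" using p by (auto simp: v_def mult_le_one)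
  define X where "X = centered p"
  note symX = symmetric_on_centered[of n p, folded X_def]
  have G: "G E = resolvent n (X E) \<eta>" for E by (simp add: G_def X_def)
  have norm_mean: "norm (graph_mean n f) \<le> C" if "\<And>E. norm (f E) \<le> C" for f :: "nat set set \<Rightarrow> complex" and C
  proof -
    have "norm (graph_mean n f) \<le> graph_mean n (\<lambda>E. norm (f E))" by (rule integral_norm_bound)
    also have "\<dots> \<le> graph_mean n (\<lambda>E. C)" by (intro integral_mono that) simp_all
    finally show ?thesis by simp
  qed
  have Gbound: "cmod (G E i j) \<le> 1 / \<eta>" if "i < n" "j < n" for E i j
    unfolding G using that assms by (intro cmod_resolvent_entry_le symX)
  define D where "D = (\<lambda>i j E. (G E j i)\<^sup>2 + G E j j * G E i i)"
  \<comment> \<open>The error of integration by parts in the pair i, j.  For i = j, where X vanishes, it is the term that completes the square of the trace.\<close>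
  define err where "err = (\<lambda>i j. graph_mean n (\<lambda>E. of_real (X E i j) * G E j i) + of_real v * graph_mean n (D i j))"
  have err: "cmod (err i j) \<le> 4 / \<eta>^3 + (if j = i then 2 / \<eta>\<^sup>2 else 0)" if "i < n" "j < n" for i j
  proof (cases "i = j")
    case True
    have "cmod (D i i E) \<le> 2 / \<eta>\<^sup>2" for E
    proof -
      have "cmod (D i i E) \<le> 1 / \<eta> * (1 / \<eta>) + 1 / \<eta> * (1 / \<eta>)"
        unfolding D_def power2_eq_square
        by (rule order_trans[OF norm_triangle_ineq], unfold norm_mult) (intro add_mono mult_mono Gbound that; use \<open>\<eta> > 0\<close> in simp)
      thus ?thesis by (simp add: power2_eq_square)
    qed
    hence "cmod (graph_mean n (D i i)) \<le> 2 / \<eta>\<^sup>2" by (rule norm_mean)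
    hence "v * cmod (graph_mean n (D i i)) \<le> 1 * (2 / \<eta>\<^sup>2)" using v by (intro mult_mono) auto
    moreover have "X E i j = 0" for E using True by (simp add: X_def centered_def)
    ultimately have "cmod (err i j) \<le> 2 / \<eta>\<^sup>2" using True v by (simp add: err_def norm_mult)
    thus ?thesis using True \<open>\<eta> > 0\<close> by (simp add: add_increasing)
  next
    case False
    define e where "e = {Suc i, Suc j}"
    have e: "e \<in> possible_edges n" using that False by (simp add: e_def edge_in_possible_edges)
    have "graph_mean n (\<lambda>E. of_real (X E i j) * G E j i)
        = graph_mean n (\<lambda>E. ((if e \<in> E then 1 else 0) - p) *\<^sub>R G E j i)"
      using False by (simp add: X_def centered_def adj_def e_def scaleR_conv_of_real)
    also have "\<dots> = of_real v * graph_mean n (\<lambda>E. G (insert e E) j i - G (E - {e}) j i)"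
      by (subst subset_mean_centered_mult[OF p_weak finite_possible_edges e]) (simp add: v_def scaleR_conv_of_real)
    finally have "err i j = of_real v * graph_mean n (\<lambda>E. (G (insert e E) j i - G (E - {e}) j i) + D i j E)"
      by (simp add: err_def distrib_left)
    moreover have "cmod (graph_mean n (\<lambda>E. (G (insert e E) j i - G (E - {e}) j i) + D i j E)) \<le> 4 / \<eta>^3"
    proof (rule norm_mean)
      fix E
      have "E = insert e E \<or> E = E - {e}" by auto
      hence "X E = X (E - {e}) \<or> X E = X (insert e E)" by metis
      moreover have "differ_by_edge n (X (E - {e})) (X (insert e E)) i j"
        unfolding X_def e_def using that False by (rule differ_by_edge_centered)
      ultimately show "cmod ((G (insert e E) j i - G (E - {e}) j i) + D i j E) \<le> 4 / \<eta>^3"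
        unfolding D_def G using \<open>\<eta> > 0\<close> by (intro resolvent_difference_error symX) auto
    qed
    hence "v * cmod (graph_mean n (\<lambda>E. (G (insert e E) j i - G (E - {e}) j i) + D i j E)) \<le> 1 * (4 / \<eta>^3)"
      using v by (intro mult_mono) auto
    ultimately show ?thesis using False v by (simp add: norm_mult)
  qed
  have lhs: "(\<Sum>i<n. \<Sum>j<n. graph_mean n (\<lambda>E. of_real (X E i j) * G E j i)) = of_nat n + \<i> * of_real \<eta> * graph_mean n T"
  proof -
    have "(\<Sum>i<n. \<Sum>j<n. graph_mean n (\<lambda>E. of_real (X E i j) * G E j i))
        = graph_mean n (\<lambda>E. \<Sum>i<n. \<Sum>j<n. of_real (X E i j) * G E j i)" by simp
    also have "(\<lambda>E. \<Sum>i<n. \<Sum>j<n. of_real (X E i j) * G E j i) = (\<lambda>E. of_nat n + \<i> * of_real \<eta> * T E)"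
      unfolding G by (rule ext) (simp add: mult_resolvent[OF symX \<open>\<eta> > 0\<close>, unfolded X_def] sum.distrib T_def trace_resolvent_def X_def sum_distrib_left)
    finally show ?thesis by simp
  qed
  have mid: "(\<Sum>i<n. \<Sum>j<n. graph_mean n (D i j)) = graph_mean n (\<lambda>E. \<Sum>i<n. \<Sum>j<n. (G E j i)\<^sup>2) + graph_mean n (\<lambda>E. (T E)\<^sup>2)"
  proof -
    have "(\<Sum>i<n. \<Sum>j<n. graph_mean n (D i j)) = graph_mean n (\<lambda>E. \<Sum>i<n. \<Sum>j<n. D i j E)" by simp
    also have "(\<lambda>E. \<Sum>i<n. \<Sum>j<n. D i j E) = (\<lambda>E. (\<Sum>i<n. \<Sum>j<n. (G E j i)\<^sup>2) + (T E)\<^sup>2)"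
      by (rule ext) (simp add: D_def T_def G_def trace_resolvent_def sum.distrib power2_eq_square sum_product mult.commute)
    finally show ?thesis by simp
  qed
  define Q where "Q = graph_mean n (\<lambda>E. \<Sum>i<n. \<Sum>j<n. (G E j i)\<^sup>2)"
  \<comment> \<open>The mean of (T - mean T)^2 without absolute value, bounded by the true variance.\<close>
  define V where "V = graph_mean n (\<lambda>E. (T E)\<^sup>2) - (graph_mean n T)\<^sup>2"
  have sum_err: "cmod (\<Sum>i<n. \<Sum>j<n. err i j) \<le> 4 * n\<^sup>2 / \<eta>^3 + 2 * n / \<eta>\<^sup>2"
  proof -
    have "cmod (\<Sum>i<n. \<Sum>j<n. err i j) \<le> (\<Sum>i<n. \<Sum>j<n. 4 / \<eta>^3 + (if j = i then 2 / \<eta>\<^sup>2 else 0))"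
      by (intro order_trans[OF norm_sum] sum_mono err) auto
    also have "\<dots> = 4 * n\<^sup>2 / \<eta>^3 + 2 * n / \<eta>\<^sup>2"
      by (simp add: sum.distrib power2_eq_square algebra_simps)
    finally show ?thesis .
  qed
  have Q: "cmod Q \<le> n / \<eta>\<^sup>2"
    unfolding Q_def
  proof (rule norm_mean)
    fix E
    have "cmod (\<Sum>i<n. \<Sum>j<n. (G E j i)\<^sup>2) \<le> (\<Sum>i<n. \<Sum>j<n. (cmod (G E i j))\<^sup>2)"
      unfolding G by (intro order_trans[OF norm_sum] sum_mono) (subst resolvent_commute, simp add: norm_power)
    also have "\<dots> \<le> (\<Sum>i<n. 1 / \<eta>\<^sup>2)"
      unfolding G by (intro sum_mono sum_cmod_resolvent_row symX \<open>\<eta> > 0\<close>) auto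
    finally show "cmod (\<Sum>i<n. \<Sum>j<n. (G E j i)\<^sup>2) \<le> n / \<eta>\<^sup>2" by simp
  qed
  have V: "cmod V \<le> 4 * n\<^sup>2 / \<eta>^4"
  proof -
    define m where "m = graph_mean n T"
    have "graph_mean n (\<lambda>E. (T E - m)\<^sup>2) = graph_mean n (\<lambda>E. (T E)\<^sup>2 - 2 * m * T E + m\<^sup>2)"
      by (simp add: power2_diff algebra_simps)
    also have "\<dots> = V" by (simp add: V_def m_def power2_eq_square)
    finally have "cmod V = cmod (graph_mean n (\<lambda>E. (T E - m)\<^sup>2))" by simp
    also have "\<dots> \<le> graph_mean n (\<lambda>E. cmod ((T E - m)\<^sup>2))" by (rule integral_norm_bound)
    also have "\<dots> = graph_mean n (\<lambda>E. (norm (T E - m))\<^sup>2)" by (simp add: norm_power)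
    also have "\<dots> \<le> (real n)\<^sup>2 * (2 / \<eta>\<^sup>2)\<^sup>2"
      unfolding T_def m_def
      by (rule bounded_difference_centered)
        (use \<open>\<eta> > 0\<close> in \<open>auto simp: norm_minus_commute intro: cmod_trace_resolvent_differ_by_edge\<close>)
    also have "(2 / \<eta>\<^sup>2)\<^sup>2 = 4 / \<eta>^4" by (simp add: power_divide flip: power_mult)
    finally show ?thesis by (simp add: mult.commute)
  qed
  have "(\<Sum>i<n. \<Sum>j<n. err i j) = of_nat n + \<i> * of_real \<eta> * graph_mean n T + of_real v * (Q + graph_mean n (\<lambda>E. (T E)\<^sup>2))"
    unfolding err_def sum.distrib lhs Q_def mid[symmetric] by (simp add: sum_distrib_left)
  hence "of_nat n + \<i> * of_real \<eta> * graph_mean n T + of_real v * (graph_mean n T)\<^sup>2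
      = (\<Sum>i<n. \<Sum>j<n. err i j) - of_real v * Q - of_real v * V"
    by (simp add: V_def algebra_simps)
  also have "cmod \<dots> \<le> cmod (\<Sum>i<n. \<Sum>j<n. err i j) + v * cmod Q + v * cmod V"
    using v by (intro order_trans[OF norm_triangle_ineq4] add_mono) (auto simp: norm_mult intro: order_trans[OF norm_triangle_ineq4])
  also have "\<dots> \<le> (4 * n\<^sup>2 / \<eta>^3 + 2 * n / \<eta>\<^sup>2) + 1 * (n / \<eta>\<^sup>2) + 1 * (4 * n\<^sup>2 / \<eta>^4)"
    using v by (intro add_mono mult_mono sum_err Q V) auto
  also have "\<dots> = 4 * n\<^sup>2 / \<eta>^3 + 3 * n / \<eta>\<^sup>2 + 4 * n\<^sup>2 / \<eta>^4" by (simp add: field_simps)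
  finally show ?thesis by (simp add: v_def)
qed

end

section \<open>The semicircle law on the imaginary axis\<close>

lemma has_bochner_integral_FTC_atLeast:
  fixes f F :: "real \<Rightarrow> real"
  assumes f: "f \<in> borel_measurable borel"
    and deriv: "\<And>x. a \<le> x \<Longrightarrow> (F has_real_derivative f x) (at x)"
    and nonneg: "\<And>x. a \<le> x \<Longrightarrow> 0 \<le> f x"
    and lim: "(F \<longlongrightarrow> T) at_top"
  shows "has_bochner_integral lborel (\<lambda>x. indicator {a..} x * f x) (T - F a)"
proof (rule has_bochner_integral_nn_integral)
  have "F a \<le> T"
  proof (rule tendsto_lowerbound[OF lim])
    show "eventually (\<lambda>x. F a \<le> F x) at_top"
      using eventually_ge_at_top[of a]
    proof eventually_elim
      case (elim x)
      show ?case
        by (rule DERIV_nonneg_imp_nondecreasing[OF elim]) (use deriv nonneg in blast)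
    qed
  qed simp
  thus "0 \<le> T - F a" by simp
  show "(\<integral>\<^sup>+ x. ennreal (indicator {a..} x * f x) \<partial>lborel) = ennreal (T - F a)"
  proof -
    have "(\<lambda>x. ennreal (indicator {a..} x * f x)) = (\<lambda>x. ennreal (f x) * indicator {a..} x)"
      by (auto simp: fun_eq_iff indicator_def)
    thus ?thesis using nn_integral_FTC_atLeast[OF f deriv nonneg lim] by simp
  qed
qed (use f nonneg in \<open>auto simp: indicator_def\<close>)

text \<open>
  The antiderivative in \<open>y\<close> is \<open>\<bar>x\<bar> arctan (y / \<bar>x\<bar>)\<close>.  For \<open>x = 0\<close> the integrand vanishes, also at
  \<open>y = 0\<close>, where it is \<open>0 / 0 = 0\<close>.
\<close>

lemma has_bochner_integral_abs_kernel:
  "has_bochner_integral lborel (\<lambda>y. indicator {0..} y * (x\<^sup>2 / (x\<^sup>2 + y\<^sup>2))) (\<bar>x\<bar> * (pi / 2))"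
proof (cases "x = 0")
  case False
  have "has_bochner_integral lborel (\<lambda>y. indicator {0..} y * (x\<^sup>2 / (x\<^sup>2 + y\<^sup>2)))
      (\<bar>x\<bar> * (pi / 2) - \<bar>x\<bar> * arctan (0 / \<bar>x\<bar>))"
  proof (rule has_bochner_integral_FTC_atLeast)
    fix y :: real
    have "1 + (y / \<bar>x\<bar>)\<^sup>2 = (x\<^sup>2 + y\<^sup>2) / x\<^sup>2" using False by (simp add: field_simps)
    moreover have "\<bar>x\<bar> * (inverse (1 + (y / \<bar>x\<bar>)\<^sup>2) * (1 / \<bar>x\<bar>)) = inverse (1 + (y / \<bar>x\<bar>)\<^sup>2)"
      using False by simp
    ultimately have "\<bar>x\<bar> * (inverse (1 + (y / \<bar>x\<bar>)\<^sup>2) * (1 / \<bar>x\<bar>)) = x\<^sup>2 / (x\<^sup>2 + y\<^sup>2)"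
      by simp
    thus "((\<lambda>y. \<bar>x\<bar> * arctan (y / \<bar>x\<bar>)) has_real_derivative x\<^sup>2 / (x\<^sup>2 + y\<^sup>2)) (at y)"
      by (rule DERIV_cong[OF DERIV_cmult[OF DERIV_chain2[OF DERIV_arctan DERIV_cdivide[OF DERIV_ident]]]])
  next
    have "filterlim (\<lambda>y. y / \<bar>x\<bar>) at_top at_top"
      using False by real_asymp
    hence "((\<lambda>y. arctan (y / \<bar>x\<bar>)) \<longlongrightarrow> pi / 2) at_top"
      by (rule filterlim_compose[OF tendsto_arctan_at_top])
    thus "((\<lambda>y. \<bar>x\<bar> * arctan (y / \<bar>x\<bar>)) \<longlongrightarrow> \<bar>x\<bar> * (pi / 2)) at_top"
      by (intro tendsto_intros)
  qed auto
  thus ?thesis by simp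
qed (simp add: has_bochner_integral_zero)

text \<open>
  The Stieltjes transform of the semicircle distribution of variance \<open>v\<close> takes the value
  \<open>\<i> semicircle_im v y\<close> at the point \<open>\<i> y\<close>.
\<close>

definition semicircle_im :: "real \<Rightarrow> real \<Rightarrow> real" where
  "semicircle_im v y = (- y + sqrt (y\<^sup>2 + 4 * v)) / (2 * v)"

lemma semicircle_im_quadratic:
  assumes "v > 0"
  shows "1 - y * semicircle_im v y = v * (semicircle_im v y)\<^sup>2"
proof -
  have "(sqrt (y\<^sup>2 + 4 * v))\<^sup>2 = y\<^sup>2 + 4 * v" using assms by simp
  hence "(2 * v * semicircle_im v y + y)\<^sup>2 = y\<^sup>2 + 4 * v" using assms by (simp add: semicircle_im_def)
  hence "4 * v * (v * (semicircle_im v y)\<^sup>2 + y * semicircle_im v y) = 4 * v * 1"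
    by (simp add: power2_eq_square algebra_simps)
  hence "v * (semicircle_im v y)\<^sup>2 + y * semicircle_im v y = 1"
    using assms by (simp only: mult_cancel_left) simp
  thus ?thesis by linarith
qed

lemma has_bochner_integral_semicircle:
  assumes v: "v > 0"
  shows "has_bochner_integral lborel (\<lambda>y. indicator {0..} y * (1 - y * semicircle_im v y)) (4 / 3 * sqrt v)"
proof -
  define F where "F = (\<lambda>y. y + y^3 / (6 * v) - (y\<^sup>2 + 4 * v) * sqrt (y\<^sup>2 + 4 * v) / (6 * v))"
  have "has_bochner_integral lborel (\<lambda>y. indicator {0..} y * (1 - y * semicircle_im v y)) (0 - F 0)"
  proof (rule has_bochner_integral_FTC_atLeast)
    show "(\<lambda>y. 1 - y * semicircle_im v y) \<in> borel_measurable borel"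
      unfolding semicircle_im_def by measurable
    show "0 \<le> 1 - y * semicircle_im v y" for y
      unfolding semicircle_im_quadratic[OF v] using v by simp
    show "(F \<longlongrightarrow> 0) at_top" unfolding F_def using v by real_asymp
    fix y :: real
    define s where "s = sqrt (y\<^sup>2 + 4 * v)"
    have s: "s > 0" "y\<^sup>2 + 4 * v = s\<^sup>2" using v by (auto simp: s_def add_nonneg_pos)
    have "((\<lambda>y. sqrt (y\<^sup>2 + 4 * v)) has_real_derivative inverse s / 2 * (2 * y)) (at y)"
      unfolding s_def using s(1)
      by (intro DERIV_chain2[OF DERIV_real_sqrt]) (auto intro!: derivative_eq_intros simp: s_def)
    moreover have "((\<lambda>y. y\<^sup>2 + 4 * v) has_real_derivative 2 * y) (at y)"
      by (auto intro!: derivative_eq_intros)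
    ultimately have "(F has_real_derivative
        1 + real 3 * y ^ (3 - Suc 0) / (6 * v)
          - (2 * y * sqrt (y\<^sup>2 + 4 * v) + inverse s / 2 * (2 * y) * (y\<^sup>2 + 4 * v)) / (6 * v)) (at y)"
      unfolding F_def
      by (intro DERIV_diff DERIV_add DERIV_ident DERIV_cdivide DERIV_pow DERIV_mult)
    also have "2 * y * sqrt (y\<^sup>2 + 4 * v) + inverse s / 2 * (2 * y) * (y\<^sup>2 + 4 * v) = 3 * y * s"
      unfolding s(2) using s(1) by (simp add: power2_eq_square field_simps)
    also have "real 3 * y ^ (3 - Suc 0) = 3 * y\<^sup>2" by simp
    also have "1 + 3 * y\<^sup>2 / (6 * v) - 3 * y * s / (6 * v) = 1 - y * semicircle_im v y"
      using v by (simp add: semicircle_im_def s_def power2_eq_square field_simps)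
    finally show "(F has_real_derivative 1 - y * semicircle_im v y) (at y)" .
  qed
  moreover have "0 - F 0 = 4 / 3 * sqrt v"
    using v by (simp add: F_def real_sqrt_mult)
  ultimately show ?thesis by (simp only:)
qed

text \<open>
  The quadratic factors as \<open>v (s - \<i> g) (s + \<i> h)\<close> with \<open>g\<close> and \<open>h\<close> positive.  As \<open>s\<close> lies in the upper
  half plane, its distance from the spurious root \<open>- \<i> h\<close> is at least \<open>h \<ge> 1 / \<surd>v\<close>.
\<close>

lemma quadratic_stability:
  fixes s :: complex
  assumes v: "v > 0" and "y > 0" and "Im s \<ge> 0"
  shows "\<bar>Im s - semicircle_im v y\<bar> \<le> cmod (1 + \<i> * of_real y * s + of_real v * s\<^sup>2) / sqrt v"
proof -
  define r where "r = sqrt (y\<^sup>2 + 4 * v)"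
  define g where "g = semicircle_im v y"
  define h where "h = (y + r) / (2 * v)"
  have r: "r\<^sup>2 = y\<^sup>2 + 4 * v" "2 * sqrt v \<le> r"
    using v by (auto simp: r_def real_sqrt_mult[symmetric] intro!: real_le_rsqrt) 
  have g: "g = (- y + r) / (2 * v)" by (simp add: g_def semicircle_im_def r_def)
  have "v * (g * h) = (r\<^sup>2 - y\<^sup>2) / (4 * v)" "v * (h - g) = y"
    using v by (simp_all add: g h_def power2_eq_square field_simps)
  hence "v * (g * h) = 1" "v * (h - g) = y" using v r(1) by simp_all
  hence "of_real v * (of_real g * of_real h) = (1 :: complex)" "of_real v * (of_real h - of_real g) = (of_real y :: complex)"
    by (metis of_real_1 of_real_mult, metis of_real_diff of_real_mult)
  hence "1 + \<i> * of_real y * s + of_real v * s\<^sup>2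
      = of_real v * (of_real g * of_real h) + \<i> * (of_real v * (of_real h - of_real g)) * s + of_real v * s\<^sup>2"
    by simp
  also have "\<dots> = of_real v * ((s - \<i> * of_real g) * (s + \<i> * of_real h))"
    by (simp add: power2_eq_square algebra_simps)
  finally have "cmod (1 + \<i> * of_real y * s + of_real v * s\<^sup>2) = v * (cmod (s - \<i> * of_real g) * cmod (s + \<i> * of_real h))"
    using v by (simp add: norm_mult)
  moreover have "1 / sqrt v \<le> cmod (s + \<i> * of_real h)"
  proof -
    have "1 / sqrt v = 2 * sqrt v / (2 * v)" using v by (simp add: real_div_sqrt field_simps)
    also have "\<dots> \<le> h" unfolding h_def using r(2) v \<open>y > 0\<close> by (intro divide_right_mono) auto
    also have "\<dots> \<le> Im (s + \<i> * of_real h)" using assms by simp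
    also have "\<dots> \<le> cmod (s + \<i> * of_real h)" using abs_Im_le_cmod[of "s + \<i> * of_real h"] by linarith
    finally show ?thesis .
  qed
  moreover have "\<bar>Im s - g\<bar> \<le> cmod (s - \<i> * of_real g)"
    using abs_Im_le_cmod[of "s - \<i> * of_real g"] by simp
  ultimately have "v * (\<bar>Im s - g\<bar> * (1 / sqrt v)) \<le> cmod (1 + \<i> * of_real y * s + of_real v * s\<^sup>2)"
    using v by (simp only:) (intro mult_left_mono mult_mono, auto)
  moreover have "v * (\<bar>Im s - g\<bar> * (1 / sqrt v)) = \<bar>Im s - g\<bar> * sqrt v"
  proof -
    have "v * (1 / sqrt v) = sqrt v" using v by (simp add: real_div_sqrt)
    thus ?thesis by (metis mult.left_commute)
  qed
  ultimately have "\<bar>Im s - g\<bar> * sqrt v \<le> cmod (1 + \<i> * of_real y * s + of_real v * s\<^sup>2)"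
    by (simp only:)
  thus ?thesis using v by (simp add: g_def pos_le_divide_eq)
qed

section \<open>The mean energy of the centered matrix\<close>

text \<open>
  The average of \<open>x\<^sup>2 / (x\<^sup>2 + y\<^sup>2)\<close> over the rescaled eigenvalues \<open>x\<close>, whose integral over \<open>y\<close> is
  \<open>\<pi> / 2\<close> times the average of \<open>\<bar>x\<bar>\<close>.
\<close>

definition spectral_filter :: "nat \<Rightarrow> (nat \<Rightarrow> nat \<Rightarrow> real) \<Rightarrow> real \<Rightarrow> real" where
  "spectral_filter n a y = (\<Sum>k<n. (eigval n a k / sqrt n)\<^sup>2 / ((eigval n a k / sqrt n)\<^sup>2 + y\<^sup>2)) / n"

lemma spectral_filter_resolvent:
  assumes a: "symmetric_on n a" and "y > 0" "n > 0"
  shows "spectral_filter n a y = 1 - y * Im (trace_resolvent n a (y * sqrt n)) / sqrt n"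
proof -
  have "y * Im (trace_resolvent n a (y * sqrt n)) / sqrt n
      = (\<Sum>k<n. y * (y * sqrt n / ((eigval n a k)\<^sup>2 + (y * sqrt n)\<^sup>2)) / sqrt n)"
    unfolding Im_trace_resolvent[OF a] by (simp add: sum_distrib_left sum_divide_distrib)
  also have "\<dots> = (\<Sum>k<n. (1 - (eigval n a k / sqrt n)\<^sup>2 / ((eigval n a k / sqrt n)\<^sup>2 + y\<^sup>2)) / n)"
  proof (intro sum.cong refl)
    fix k
    define x where "x = (eigval n a k)\<^sup>2"
    have "x \<ge> 0" by (simp add: x_def)
    hence pos: "x + n * y\<^sup>2 > 0" using assms by (intro add_nonneg_pos) auto
    have "y * (y * sqrt n / (x + (y * sqrt n)\<^sup>2)) / sqrt n = y\<^sup>2 / (x + n * y\<^sup>2)"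
      using assms by (simp add: power_mult_distrib power2_eq_square mult.commute)
    also have "\<dots> = (1 - x / (x + n * y\<^sup>2)) / n"
    proof -
      have "1 - x / (x + n * y\<^sup>2) = (x + n * y\<^sup>2 - x) / (x + n * y\<^sup>2)"
        using pos by (subst diff_divide_distrib) simp
      thus ?thesis using assms by simp
    qed
    also have "x / (x + n * y\<^sup>2) = (x / n) / (x / n + y\<^sup>2)"
      using pos assms by (simp add: field_simps)
    finally show "y * (y * sqrt n / ((eigval n a k)\<^sup>2 + (y * sqrt n)\<^sup>2)) / sqrt n
        = (1 - (eigval n a k / sqrt n)\<^sup>2 / ((eigval n a k / sqrt n)\<^sup>2 + y\<^sup>2)) / n"
      by (simp add: x_def power_divide)
  qed
  also have "\<dots> = 1 - spectral_filter n a y"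
    using assms by (simp add: spectral_filter_def sum_subtractf flip: sum_divide_distrib) (simp add: diff_divide_distrib)
  finally show ?thesis by simp
qed

lemma spectral_filter_nonneg: "0 \<le> spectral_filter n a y"
  unfolding spectral_filter_def by (intro divide_nonneg_nonneg sum_nonneg) auto

text \<open>
  An integrable bound that is uniform in the graph.  The filter is at most \<open>1\<close>, and at most the
  average of \<open>x\<^sup>2\<close>, which is the squared Frobenius norm over \<open>n\<^sup>2\<close>, divided by \<open>y\<^sup>2\<close>; the lemma combines the two.
\<close>

lemma spectral_filter_le:
  assumes a: "symmetric_on n a" and bd: "\<And>i j. i < n \<Longrightarrow> j < n \<Longrightarrow> \<bar>a i j\<bar> \<le> 1" 
  shows "spectral_filter n a y \<le> 2 * (1 / (1 + y\<^sup>2))"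
proof (cases "n = 0")
  case False
  let ?x = "\<lambda>k. (eigval n a k / sqrt n)\<^sup>2"
  have frob: "(\<Sum>k<n. (eigval n a k)\<^sup>2) \<le> (real n)\<^sup>2"
  proof -
    have "(\<Sum>k<n. (eigval n a k)\<^sup>2) \<le> (\<Sum>i<n. \<Sum>j<n. 1)"
      unfolding sum_eigval_squares[OF a] using bd by (intro sum_mono) (simp add: abs_square_le_1)
    thus ?thesis by (simp add: power2_eq_square)
  qed
  \<comment> \<open>Clearing denominators leaves 0 \<le> z + t^2.\<close>
  have ratio: "t / (t + z) \<le> (1 + t) / (1 + z)" if "t \<ge> 0" "z \<ge> 0" for t z :: real
  proof (cases "t + z = 0")
    case False
    hence "t + z > 0" using that by simp
    moreover have "t * (1 + z) \<le> (1 + t) * (t + z)" using that by (simp add: algebra_simps)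
    ultimately show ?thesis using that by (simp add: divide_simps mult.commute)
  qed (use that in simp)
  have filter_bound: "?x k / (?x k + y\<^sup>2) \<le> (1 + ?x k) / (1 + y\<^sup>2)" for k
    by (rule ratio) auto
  have "spectral_filter n a y \<le> (\<Sum>k<n. (1 + ?x k) / (1 + y\<^sup>2)) / n"
    unfolding spectral_filter_def by (intro divide_right_mono sum_mono filter_bound) auto
  also have "\<dots> = (n + (\<Sum>k<n. (eigval n a k)\<^sup>2) / n) / (1 + y\<^sup>2) / n"
    by (simp add: sum.distrib power_divide flip: sum_divide_distrib)
  also have "\<dots> \<le> (n + (real n)\<^sup>2 / n) / (1 + y\<^sup>2) / n"
    by (intro divide_right_mono add_left_mono frob) (auto intro: add_nonneg_nonneg)
  also have "\<dots> = 2 * (1 / (1 + y\<^sup>2))" using False by (simp add: power2_eq_square)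
  finally show ?thesis .
qed (simp add: spectral_filter_def)

lemma has_bochner_integral_spectral_filter:
  "has_bochner_integral lborel (\<lambda>y. indicator {0..} y * spectral_filter n a y)
     (pi / 2 * (fun_energy n a / (n * sqrt n)))"
proof -
  have "has_bochner_integral lborel
      (\<lambda>y. (\<Sum>k<n. indicator {0..} y * ((eigval n a k / sqrt n)\<^sup>2 / ((eigval n a k / sqrt n)\<^sup>2 + y\<^sup>2))) / n)
      ((\<Sum>k<n. \<bar>eigval n a k / sqrt n\<bar> * (pi / 2)) / n)"
    by (intro has_bochner_integral_divide_zero has_bochner_integral_sum has_bochner_integral_abs_kernel)
  thus ?thesis
    by (simp add: spectral_filter_def fun_energy_def sum_distrib_left sum_divide_distrib mult_ac
      times_divide_eq_right del: times_divide_eq_left)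
qed

context
  fixes p :: real
  assumes p: "0 < p" "p < 1"
begin

abbreviation "mean_filter n y \<equiv> graph_mean p n (\<lambda>E. spectral_filter n (centered p E) y)"

lemma tendsto_mean_filter:
  assumes "y > 0"
  shows "(\<lambda>n. mean_filter n y) \<longlonglongrightarrow> 1 - y * semicircle_im (p * (1 - p)) y"
proof -
  define v where "v = p * (1 - p)"
  have v: "v > 0" using p by (simp add: v_def)
  define T where "T = (\<lambda>n. graph_mean p n (\<lambda>E. trace_resolvent n (centered p E) (y * sqrt n)))"
  define s where "s = (\<lambda>n. T n / of_real (sqrt n))"
  define \<delta> where "\<delta> = (\<lambda>n::nat. 4 / (y^3 * sqrt n) + 3 / (y\<^sup>2 * n) + 4 / (y^4 * n))"
  have T: "Im (T n) = graph_mean p n (\<lambda>E. Im (trace_resolvent n (centered p E) (y * sqrt n)))" for n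
    unfolding T_def by (rule integral_Im[symmetric]) simp
  have bound: "\<bar>Im (s n) - semicircle_im v y\<bar> \<le> \<delta> n / sqrt v" if "n > 0" for n
  proof -
    have n: "real n > 0" "sqrt n * sqrt n = n" using that by auto
    have "Im (s n) \<ge> 0"
      unfolding s_def Im_divide_of_real T Im_trace_resolvent[OF symmetric_on_centered]
      using assms by (intro divide_nonneg_nonneg Bochner_Integration.integral_nonneg sum_nonneg) auto
    from quadratic_stability[OF v assms this]
    have "\<bar>Im (s n) - semicircle_im v y\<bar> \<le> cmod (1 + \<i> * of_real y * s n + of_real v * (s n)\<^sup>2) / sqrt v" .
    also have "1 + \<i> * of_real y * s n + of_real v * (s n)\<^sup>2
        = (of_nat n + \<i> * of_real (y * sqrt n) * T n + of_real v * (T n)\<^sup>2) / of_nat n"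
    proof -
      have c: "of_real (sqrt n) * of_real (sqrt n) = (of_nat n :: complex)"
        unfolding of_real_mult[symmetric] n(2) by simp
      have c0: "of_real (sqrt n) \<noteq> (0 :: complex)" using that by simp
      show ?thesis unfolding s_def c[symmetric] of_real_mult power2_eq_square using c0
        by (simp add: field_simps)
    qed
    also have "cmod \<dots> = cmod (of_nat n + \<i> * of_real (y * sqrt n) * T n + of_real v * (T n)\<^sup>2) / n"
      by (simp add: norm_divide)
    also have "\<dots> \<le> (4 * n\<^sup>2 / (y * sqrt n)^3 + 3 * n / (y * sqrt n)\<^sup>2 + 4 * n\<^sup>2 / (y * sqrt n)^4) / n"
      unfolding T_def v_def using assms that by (intro divide_right_mono loop_equation p) auto
    also have "\<dots> = \<delta> n"
    proof -
      have "(y * sqrt n)^3 = y^3 * (n * sqrt n)" "(y * sqrt n)\<^sup>2 = y\<^sup>2 * n" "(y * sqrt n)^4 = y^4 * (real n)\<^sup>2"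
        using n by (simp_all add: power_mult_distrib power3_eq_cube power2_eq_square power4_eq_xxxx)
      thus ?thesis unfolding \<delta>_def using n assms
        by (simp only:) (simp add: power2_eq_square add_divide_distrib)
    qed
    finally show ?thesis using v by (simp add: divide_right_mono)
  qed
  have "\<delta> \<longlonglongrightarrow> 0" unfolding \<delta>_def using assms by real_asymp
  hence "(\<lambda>n. \<delta> n / sqrt v) \<longlonglongrightarrow> 0" by (rule tendsto_divide_zero)
  hence "(\<lambda>n. Im (s n) - semicircle_im v y) \<longlonglongrightarrow> 0"
    by (rule Lim_null_comparison[rotated]) (use bound in \<open>auto intro!: eventually_sequentiallyI[of 1]\<close>)
  hence "(\<lambda>n. Im (s n)) \<longlonglongrightarrow> semicircle_im v y" by (simp add: LIM_zero_iff)
  hence "(\<lambda>n. 1 - y * Im (s n)) \<longlonglongrightarrow> 1 - y * semicircle_im v y" by (intro tendsto_intros)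
  moreover have "eventually (\<lambda>n. 1 - y * Im (s n) = mean_filter n y) sequentially"
    using eventually_gt_at_top[of 0]
  proof eventually_elim
    case (elim n)
    have "mean_filter n y = graph_mean p n (\<lambda>E. 1 - y * Im (trace_resolvent n (centered p E) (y * sqrt n)) / sqrt n)"
      by (simp add: spectral_filter_resolvent[OF symmetric_on_centered assms elim])
    also have "\<dots> = 1 - y * Im (s n)"
      by (simp add: s_def T Im_divide_of_real)
    finally show ?case by simp
  qed
  ultimately show ?thesis unfolding v_def by (rule Lim_transform_eventually)
qed

lemma abs_centered_le: "\<bar>centered p E i j\<bar> \<le> 1"
  using p by (auto simp: centered_def adj_def)

theorem mean_energy_centered:
  "(\<lambda>n. graph_mean p n (\<lambda>E. fun_energy n (centered p E)) / (n * sqrt n)) \<longlonglongrightarrow> 8 / (3 * pi) * sqrt (p * (1 - p))"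
proof -
  define v where "v = p * (1 - p)"
  have v: "v > 0" using p by (simp add: v_def)
  have hbi: "has_bochner_integral lborel (\<lambda>y. indicator {0..} y * mean_filter n y)
      (pi / 2 * (graph_mean p n (\<lambda>E. fun_energy n (centered p E)) / (n * sqrt n)))" for n
  proof -
    \<comment> \<open>The mean is a finite sum over graphs, so it commutes with the integral over y.\<close>
    have sum: "graph_mean p n f = (\<Sum>E\<in>Pow (possible_edges n). pmf (random_subset p (possible_edges n)) E * f E)"
      for f :: "_ \<Rightarrow> real"
      using set_pmf_random_subset[of p "possible_edges n"]
      by (subst integral_measure_pmf[of "Pow (possible_edges n)"]) auto
    show ?thesis
      unfolding sum sum_distrib_left sum_divide_distrib
    proof (rule has_bochner_integral_sum)
      fix E
      have "has_bochner_integral lborel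
          (\<lambda>y. pmf (random_subset p (possible_edges n)) E * (indicator {0..} y * spectral_filter n (centered p E) y))
          (pmf (random_subset p (possible_edges n)) E * (pi / 2 * (fun_energy n (centered p E) / (n * sqrt n))))"
        by (intro has_bochner_integral_mult_right has_bochner_integral_spectral_filter)
      thus "has_bochner_integral lborel
          (\<lambda>y. indicator {0..} y * (pmf (random_subset p (possible_edges n)) E * spectral_filter n (centered p E) y))
          (pi / 2 * (pmf (random_subset p (possible_edges n)) E * fun_energy n (centered p E) / (n * sqrt n)))"
        by (simp add: mult_ac)
    qed
  qed
  have "(\<lambda>n. \<integral>y. indicator {0..} y * mean_filter n y \<partial>lborel)
      \<longlonglongrightarrow> (\<integral>y. indicator {0..} y * (1 - y * semicircle_im v y) \<partial>lborel)"
  proof (rule integral_dominated_convergence)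
    show "(\<lambda>y. indicator {0..} y * (1 - y * semicircle_im v y)) \<in> borel_measurable lborel"
      using has_bochner_integral_semicircle[OF v] by (auto simp: has_bochner_integral_iff)
    show "(\<lambda>y. indicator {0..} y * mean_filter n y) \<in> borel_measurable lborel" for n
      using hbi[of n] by (auto simp: has_bochner_integral_iff)
    have "integrable lborel (\<lambda>y::real. indicator {0..} y * (1 / (1 + y\<^sup>2)))"
      using has_bochner_integral_abs_kernel[of 1] by (auto simp: has_bochner_integral_iff)
    thus "integrable lborel (\<lambda>y::real. 2 * (indicator {0..} y * (1 / (1 + y\<^sup>2))))"
      by (rule integrable_mult_right)
    show "AE y in lborel. (\<lambda>n. indicator {0..} y * mean_filter n y)
        \<longlonglongrightarrow> indicator {0..} y * (1 - y * semicircle_im v y)"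
      \<comment> \<open>At y = 0 the filter is the fraction of nonzero eigenvalues, about which the resolvent gives no information.\<close>
      using AE_lborel_singleton[of "0::real"]
    proof eventually_elim
      case (elim y)
      show ?case
      proof (cases "y > 0")
        case True
        thus ?thesis unfolding v_def by (intro tendsto_intros tendsto_mean_filter)
      qed (use elim in simp)
    qed
    fix n
    show "AE y in lborel. norm (indicator {0..} y * mean_filter n y) \<le> 2 * (indicator {0..} y * (1 / (1 + y\<^sup>2)))"
    proof (rule AE_I2)
      fix y :: real
      have "mean_filter n y \<le> graph_mean p n (\<lambda>_. 2 * (1 / (1 + y\<^sup>2)))"
        by (intro integral_mono spectral_filter_le symmetric_on_centered abs_centered_le) simp_all
      moreover have "0 \<le> mean_filter n y"
        by (intro Bochner_Integration.integral_nonneg spectral_filter_nonneg)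
      ultimately show "norm (indicator {0..} y * mean_filter n y) \<le> 2 * (indicator {0..} y * (1 / (1 + y\<^sup>2)))"
        by (simp add: indicator_def)
    qed
  qed
  hence "(\<lambda>n. pi / 2 * (graph_mean p n (\<lambda>E. fun_energy n (centered p E)) / (n * sqrt n))) \<longlonglongrightarrow> 4 / 3 * sqrt v"
    unfolding has_bochner_integral_integral_eq[OF hbi]
      has_bochner_integral_integral_eq[OF has_bochner_integral_semicircle[OF v]] .
  hence "(\<lambda>n. 2 / pi * (pi / 2 * (graph_mean p n (\<lambda>E. fun_energy n (centered p E)) / (n * sqrt n))))
      \<longlonglongrightarrow> 2 / pi * (4 / 3 * sqrt v)"
    by (rule tendsto_mult[OF tendsto_const])
  thus ?thesis by (simp add: v_def mult.commute)
qed

end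

section \<open>From the centered matrix to the Zagreb matrix\<close>

text \<open>
  The difference is \<open>p (J - 1)\<close> with \<open>J\<close> the all-ones matrix, and
  \<open>tr (W J)\<close> and \<open>tr W\<close> are both at most \<open>n\<close> in absolute value for orthogonal \<open>W\<close>.  The Frobenius
  norm would only give \<open>n\<^sup>3\<^sup>/\<^sup>2\<close>, the order of the main term.
\<close>

lemma energy_adj_centered:
  assumes p: "0 \<le> p" "p \<le> 1" and E: "E \<subseteq> possible_edges n"
  shows "\<bar>fun_energy n (adj E) - fun_energy n (centered p E)\<bar> \<le> 2 * real n"
proof (rule energy_diff_le[OF symmetric_on_adj symmetric_on_centered])
  fix w assume w: "orthogonal_on n w"
  have no_loop: "adj E i i = 0" for i using E by (auto simp: adj_def possible_edges_def)
  have "(\<Sum>i<n. \<Sum>j<n. w i j * (adj E i j - centered p E i j))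
      = (\<Sum>i<n. \<Sum>j<n. p * (w i j - (if j = i then w i j else 0)))"
    by (intro sum.cong refl) (auto simp: centered_def no_loop)
  also have "\<dots> = p * ((\<Sum>i<n. \<Sum>j<n. w i j) - (\<Sum>i<n. w i i))"
    by (simp add: sum_subtractf flip: sum_distrib_left)
  finally have eq: "(\<Sum>i<n. \<Sum>j<n. w i j * (adj E i j - centered p E i j))
      = p * ((\<Sum>i<n. \<Sum>j<n. w i j) - (\<Sum>i<n. w i i))" .
  have "\<bar>\<Sum>i<n. \<Sum>j<n. w i j\<bar> \<le> n"
    using orthogonal_on_bilinear[OF w, of "\<lambda>_. 1" "\<lambda>_. 1"] by simp
  moreover have "\<bar>\<Sum>i<n. w i i\<bar> \<le> (\<Sum>i<n. 1)"
    by (intro order_trans[OF sum_abs] sum_mono abs_orthogonal_entry_le_1[OF w]) auto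
  ultimately have "\<bar>(\<Sum>i<n. \<Sum>j<n. w i j) - (\<Sum>i<n. w i i)\<bar> \<le> 2 * real n" by simp
  hence "p * \<bar>(\<Sum>i<n. \<Sum>j<n. w i j) - (\<Sum>i<n. w i i)\<bar> \<le> 1 * (2 * real n)"
    using p by (intro mult_mono) auto
  thus "\<bar>\<Sum>i<n. \<Sum>j<n. w i j * (adj E i j - centered p E i j)\<bar> \<le> 2 * real n"
    unfolding eq using p by (simp add: abs_mult)
qed

definition ln_prod2 :: "nat set set \<Rightarrow> nat \<Rightarrow> nat \<Rightarrow> real" where
  "ln_prod2 E i j = adj E i j * (ln (degree_of E (Suc i)) + ln (degree_of E (Suc j)))"

lemma ln_prod2_matrix_eq: "ln_prod2_matrix n E = mat n n (\<lambda>(i, j). ln_prod2 E i j)"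
  by (rule eq_matI) (auto simp: ln_prod2_matrix_def ln_prod2_def adj_def)

lemma symmetric_on_ln_prod2: "symmetric_on n (ln_prod2 E)"
  using symmetric_on_adj[of n E] by (simp add: symmetric_on_def ln_prod2_def add.commute)

text \<open>
  The logarithm of the degree relative to \<open>n\<close>, so that an entry of the Zagreb matrix at an edge
  exceeds \<open>2 ln n\<close> by a sum of two such terms.
\<close>

definition log_ratio :: "nat \<Rightarrow> nat set set \<Rightarrow> nat \<Rightarrow> real" where
  "log_ratio n E i = (if degree_of E (Suc i) = 0 then 0 else ln (degree_of E (Suc i) / n))"

lemma energy_ln_prod2_adj:
  assumes E: "finite E" and n: "n > 0"
  shows "\<bar>fun_energy n (ln_prod2 E) - 2 * ln n * fun_energy n (adj E)\<bar>
    \<le> 2 * real n * sqrt (\<Sum>i<n. (log_ratio n E i)\<^sup>2)"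
proof -
  have sym: "symmetric_on n (\<lambda>i j. 2 * ln n * adj E i j)"
    using symmetric_on_adj[of n E] by (simp add: symmetric_on_def)
  have "(ln_prod2 E i j - 2 * ln n * adj E i j)\<^sup>2 \<le> 2 * (log_ratio n E i)\<^sup>2 + 2 * (log_ratio n E j)\<^sup>2"
    for i j
  proof (cases "{Suc i, Suc j} \<in> E")
    case True
    have "degree_of E (Suc i) > 0" "degree_of E (Suc j) > 0"
      using True E unfolding degree_of_def by (auto simp: card_gt_0_iff)
    hence "ln_prod2 E i j - 2 * ln n * adj E i j = log_ratio n E i + log_ratio n E j"
      using True n by (simp add: ln_prod2_def adj_def log_ratio_def ln_div)
    moreover have "0 \<le> (log_ratio n E i - log_ratio n E j)\<^sup>2" by simp
    ultimately show ?thesis by (simp add: power2_sum power2_diff)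
  qed (simp add: ln_prod2_def adj_def)
  hence "(\<Sum>i<n. \<Sum>j<n. (ln_prod2 E i j - 2 * ln n * adj E i j)\<^sup>2)
      \<le> (\<Sum>i<n. \<Sum>j<n. 2 * (log_ratio n E i)\<^sup>2 + 2 * (log_ratio n E j)\<^sup>2)"
    by (intro sum_mono)
  also have "\<dots> = 4 * n * (\<Sum>i<n. (log_ratio n E i)\<^sup>2)"
    by (simp add: sum.distrib flip: sum_distrib_left)
  finally have frob: "(\<Sum>i<n. \<Sum>j<n. (ln_prod2 E i j - 2 * ln n * adj E i j)\<^sup>2) \<le> \<dots>" .
  have "\<bar>fun_energy n (ln_prod2 E) - 2 * ln n * fun_energy n (adj E)\<bar>
      \<le> sqrt (n * (\<Sum>i<n. \<Sum>j<n. (ln_prod2 E i j - 2 * ln n * adj E i j)\<^sup>2))"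
    using energy_diff_le_frobenius[OF symmetric_on_ln_prod2 sym]
      energy_cmult[OF symmetric_on_adj, of "2 * ln n" n E] n by simp
  also have "\<dots> \<le> sqrt (n * (4 * n * (\<Sum>i<n. (log_ratio n E i)\<^sup>2)))"
    by (intro real_sqrt_le_mono mult_left_mono frob) simp
  also have "\<dots> = 2 * real n * sqrt (\<Sum>i<n. (log_ratio n E i)\<^sup>2)"
    by (simp add: real_sqrt_mult)
  finally show ?thesis .
qed

definition edges_at :: "nat \<Rightarrow> nat \<Rightarrow> nat set set" where
  "edges_at n v = {e \<in> possible_edges n. v \<in> e}"

lemma card_edges_at:
  assumes "v \<in> {1..n}"
  shows "card (edges_at n v) = n - 1"
proof -
  have "edges_at n v = (\<lambda>u. {v, u}) ` ({1..n} - {v})"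
    using assms by (fastforce simp: edges_at_def possible_edges_def card_2_iff doubleton_eq_iff)
  moreover have "inj_on (\<lambda>u. {v, u}) ({1..n} - {v})"
    by (auto simp: inj_on_def doubleton_eq_iff)
  ultimately show ?thesis using assms by (simp add: card_image)
qed

lemma degree_of_eq_sum:
  assumes "E \<subseteq> possible_edges n"
  shows "real (degree_of E v) = (\<Sum>e\<in>edges_at n v. if e \<in> E then 1 else 0)"
proof -
  have "{e \<in> E. v \<in> e} = {e \<in> edges_at n v. e \<in> E}" using assms by (auto simp: edges_at_def)
  moreover have "finite (edges_at n v)" by (simp add: edges_at_def)
  ultimately show ?thesis by (simp add: degree_of_def flip: sum.inter_filter)
qed

lemma degree_of_le:
  assumes "E \<subseteq> possible_edges n" "v \<in> {1..n}"
  shows "degree_of E v \<le> n"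
proof -
  have "degree_of E v \<le> card (edges_at n v)"
    unfolding degree_of_def using assms by (intro card_mono) (auto simp: edges_at_def)
  thus ?thesis using card_edges_at[OF assms(2)] by simp
qed

text \<open>
  If the degree is at least \<open>n p / 2\<close> the first term suffices.  Otherwise the degree still lies between \<open>1\<close>
  and \<open>n\<close>, which bounds the logarithm by \<open>ln n\<close>, and the deviation of the degree from \<open>n p\<close> is so large that the
  last factor is at least \<open>1\<close>; its mean is \<open>O(1 / n)\<close> by the variance of the degree.
\<close>

lemma log_ratio_square_le:
  fixes p :: real
  assumes p: "0 < p" "p < 1" and E: "E \<subseteq> possible_edges n" and i: "i < n"
  shows "(log_ratio n E i)\<^sup>2
    \<le> (ln (2 / p))\<^sup>2 + (ln n)\<^sup>2 * (4 * (degree_of E (Suc i) - n * p)\<^sup>2 / (n * p)\<^sup>2)"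
proof (cases "degree_of E (Suc i) = 0")
  case False
  define d where "d = real (degree_of E (Suc i))"
  have d: "1 \<le> d" "d \<le> n" using False degree_of_le[OF E, of "Suc i"] i by (auto simp: d_def)
  have L: "log_ratio n E i = - ln (n / d)" using False d i by (simp add: log_ratio_def d_def ln_div)
  have np: "n * p > 0" using p i by simp
  have nonneg: "0 \<le> ln (n / d)" using d by simp
  show ?thesis
  proof (cases "n * p / 2 \<le> d")
    case True
    have "n / d \<le> 2 / p" using True d p by (simp add: field_simps)
    hence "ln (n / d) \<le> ln (2 / p)" using d by (subst ln_le_cancel_iff) (use p i in auto)
    hence "(log_ratio n E i)\<^sup>2 \<le> (ln (2 / p))\<^sup>2" unfolding L using nonneg by (simp add: power_mono)
    moreover have "0 \<le> (ln n)\<^sup>2 * (4 * (d - n * p)\<^sup>2 / (n * p)\<^sup>2)" by simp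
    ultimately show ?thesis unfolding d_def by linarith
  next
    case False
    have "n / d \<le> n" using d by (simp add: divide_le_eq)
    hence "ln (n / d) \<le> ln n" using d by (subst ln_le_cancel_iff) (use i in auto)
    hence "(log_ratio n E i)\<^sup>2 \<le> (ln n)\<^sup>2 * 1" unfolding L using nonneg by (simp add: power_mono)
    also have "1 \<le> 4 * (d - n * p)\<^sup>2 / (n * p)\<^sup>2"
    proof -
      have "n * p / 2 \<le> \<bar>d - n * p\<bar>" using False np by linarith
      hence "(n * p / 2)\<^sup>2 \<le> (d - n * p)\<^sup>2" using np by (metis abs_of_pos abs_le_square_iff half_gt_zero)
      hence "(n * p)\<^sup>2 \<le> 4 * (d - n * p)\<^sup>2" by (simp add: power_divide)
      moreover have "(n * p)\<^sup>2 > 0" using np by (rule zero_less_power)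
      ultimately show ?thesis by (simp only: le_divide_eq_1_pos)
    qed
    hence "(ln n)\<^sup>2 * 1 \<le> (ln n)\<^sup>2 * (4 * (d - n * p)\<^sup>2 / (n * p)\<^sup>2)" by (intro mult_left_mono) auto
    finally show ?thesis unfolding d_def by (simp add: add_increasing)
  qed
qed (simp add: log_ratio_def)

context
  fixes p :: real
  assumes p: "0 < p" "p < 1"
begin

text \<open>
  Switching an edge changes the degree by one if the edge meets the vertex and not at all otherwise.
  Centering at \<open>n p\<close> instead of \<open>(n - 1) p\<close> costs a bounded term, absorbed by the constant.
\<close>

lemma degree_variance:
  assumes "v \<in> {1..n}"
  shows "graph_mean p n (\<lambda>E. (degree_of E v - n * p)\<^sup>2) \<le> 4 * real n"
proof -
  define d where "d = (\<lambda>E. \<Sum>e\<in>edges_at n v. if e \<in> E then 1 else 0 :: real)"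
  have fin: "finite (edges_at n v)" by (simp add: edges_at_def)
  have n: "n \<ge> 1" using assms by simp
  have mean: "graph_mean p n d = (n - 1) * p"
  proof -
    have "graph_mean p n d = (\<Sum>e\<in>edges_at n v. graph_mean p n (\<lambda>E. if e \<in> E then 1 else 0))"
      unfolding d_def by simp
    also have "\<dots> = (\<Sum>e\<in>edges_at n v. p)"
      using p by (intro sum.cong refl subset_mean_indicator) (auto simp: edges_at_def)
    finally show ?thesis by (simp add: card_edges_at[OF assms])
  qed
  have "graph_mean p n (\<lambda>E. (norm (d E - graph_mean p n d))\<^sup>2)
      \<le> (\<Sum>e\<in>possible_edges n. (if v \<in> e then 1 else 0 :: real)\<^sup>2)"
  proof (rule bounded_differences_variance)
    fix e T assume e: "e \<in> possible_edges n" and T: "T \<subseteq> possible_edges n - {e}"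
    have "d (insert e T) - d T = (\<Sum>x\<in>edges_at n v. if x = e then 1 else 0)"
      unfolding d_def sum_subtractf[symmetric] using T by (intro sum.cong) auto
    also have "\<dots> = (if v \<in> e then 1 else 0)" using e fin by (simp add: edges_at_def)
    finally show "norm (d (insert e T) - d T) \<le> (if v \<in> e then 1 else 0)" by simp
  qed (use p in auto)
  also have "(\<Sum>e\<in>possible_edges n. (if v \<in> e then 1 else 0 :: real)\<^sup>2) = card (edges_at n v)"
    by (simp add: edges_at_def if_distrib[of "\<lambda>c. c\<^sup>2"] flip: sum.inter_filter cong: if_cong)
  finally have var: "graph_mean p n (\<lambda>E. (d E - (n - 1) * p)\<^sup>2) \<le> n - 1"
    unfolding mean card_edges_at[OF assms] by simp
  have "graph_mean p n (\<lambda>E. (degree_of E v - n * p)\<^sup>2) \<le> graph_mean p n (\<lambda>E. 2 * (d E - (n - 1) * p)\<^sup>2 + 2)"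
  proof (rule subset_mean_mono)
    fix E assume "E \<subseteq> possible_edges n"
    hence "degree_of E v - n * p = (d E - (n - 1) * p) + (- p)"
      using n by (simp add: degree_of_eq_sum d_def of_nat_diff algebra_simps)
    hence "(degree_of E v - n * p)\<^sup>2 \<le> 2 * (d E - (n - 1) * p)\<^sup>2 + 2 * (- p)\<^sup>2"
      using sum_squares_bound[of "d E - (n - 1) * p" "- p"] by (simp only: power2_sum)
    moreover have "p\<^sup>2 \<le> 1" using p by (simp add: power_le_one)
    ultimately show "(degree_of E v - n * p)\<^sup>2 \<le> 2 * (d E - (n - 1) * p)\<^sup>2 + 2" by simp
  qed simp
  also have "\<dots> = 2 * graph_mean p n (\<lambda>E. (d E - (n - 1) * p)\<^sup>2) + 2" by simp
  also have "\<dots> \<le> 4 * real n" using var n by (simp add: of_nat_diff)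
  finally show ?thesis .
qed

lemma mean_sum_log_ratio:
  assumes "n > 0"
  shows "graph_mean p n (\<lambda>E. \<Sum>i<n. (log_ratio n E i)\<^sup>2) \<le> n * (ln (2 / p))\<^sup>2 + 16 * (ln n)\<^sup>2 / p\<^sup>2"
proof -
  have "graph_mean p n (\<lambda>E. \<Sum>i<n. (log_ratio n E i)\<^sup>2) = (\<Sum>i<n. graph_mean p n (\<lambda>E. (log_ratio n E i)\<^sup>2))"
    by simp
  also have "\<dots> \<le> (\<Sum>i<n. (ln (2 / p))\<^sup>2 + (ln n)\<^sup>2 * (4 * (4 * n) / (n * p)\<^sup>2))"
  proof (rule sum_mono)
    fix i assume "i \<in> {..<n}"
    hence i: "i < n" by simp
    have "graph_mean p n (\<lambda>E. (log_ratio n E i)\<^sup>2)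
        \<le> graph_mean p n (\<lambda>E. (ln (2 / p))\<^sup>2 + (ln n)\<^sup>2 * (4 * (degree_of E (Suc i) - n * p)\<^sup>2 / (n * p)\<^sup>2))"
      by (intro subset_mean_mono log_ratio_square_le p i finite_possible_edges)
    also have "\<dots> = (ln (2 / p))\<^sup>2 + (ln n)\<^sup>2 * (4 * graph_mean p n (\<lambda>E. (degree_of E (Suc i) - n * p)\<^sup>2) / (n * p)\<^sup>2)"
      by simp
    also have "\<dots> \<le> (ln (2 / p))\<^sup>2 + (ln n)\<^sup>2 * (4 * (4 * n) / (n * p)\<^sup>2)"
      using degree_variance[of "Suc i" n] i
      by (intro add_left_mono mult_left_mono divide_right_mono) auto
    finally show "graph_mean p n (\<lambda>E. (log_ratio n E i)\<^sup>2) \<le> \<dots>" .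
  qed
  also have "\<dots> = n * (ln (2 / p))\<^sup>2 + 16 * (ln n)\<^sup>2 / p\<^sup>2"
    using assms p by (simp add: power_mult_distrib power2_eq_square field_simps)
  finally show ?thesis .
qed

definition energy_error :: "nat \<Rightarrow> real" where
  "energy_error n = graph_mean p n (\<lambda>E. fun_energy n (centered p E)) / (n * sqrt n) - 8 / (3 * pi) * sqrt (p * (1 - p))"

text \<open>
  The deviation is a sum of four parts: fluctuating degrees, the passage from
  the adjacency matrix to the centered one, the fluctuation of the energy of the centered matrix, and the
  deterministic error of its mean.  The square of the sum is at most four times the sum of the squares.
\<close>

lemma mean_square_deviation:
  assumes n: "n > 1"
  shows "graph_mean p n (\<lambda>E. (fun_energy n (ln_prod2 E) / (2 * ln n * (n * sqrt n)) - 8 / (3 * pi) * sqrt (p * (1 - p)))\<^sup>2)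
    \<le> 4 * ((ln (2 / p))\<^sup>2 / (ln n)\<^sup>2 + 16 / (p\<^sup>2 * n) + 8 / n + (energy_error n)\<^sup>2)"
proof -
  define N where "N = n * sqrt n"
  define \<mu> where "\<mu> = graph_mean p n (\<lambda>E. fun_energy n (centered p E))"
  define \<kappa> where "\<kappa> = 8 / (3 * pi) * sqrt (p * (1 - p))"
  have n0: "real n > 0" and ln0: "ln n > 0" using n by auto
  have N: "N > 0" "N\<^sup>2 = real n ^ 3" using n by (auto simp: N_def power_mult_distrib power3_eq_cube power2_eq_square)
  define W where "W = (\<lambda>E. 4 * ((\<Sum>i<n. (log_ratio n E i)\<^sup>2) / (n * (ln n)\<^sup>2) + 4 / n
    + (norm (fun_energy n (centered p E) - \<mu>))\<^sup>2 / N\<^sup>2 + (energy_error n)\<^sup>2))"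
  have pointwise: "(fun_energy n (ln_prod2 E) / (2 * ln n * N) - \<kappa>)\<^sup>2 \<le> W E" if E: "E \<subseteq> possible_edges n" for E
  proof -
    have finE: "finite E" using E by (rule finite_subset) simp
    define a where "a = (fun_energy n (ln_prod2 E) - 2 * ln n * fun_energy n (adj E)) / (2 * ln n * N)"
    define b where "b = (fun_energy n (adj E) - fun_energy n (centered p E)) / N"
    define c where "c = (fun_energy n (centered p E) - \<mu>) / N"
    have split: "fun_energy n (ln_prod2 E) / (2 * ln n * N) - \<kappa> = a + b + c + energy_error n"
      using N ln0 by (simp add: a_def b_def c_def energy_error_def \<mu>_def \<kappa>_def N_def[symmetric] diff_divide_distrib)
    have four: "(w + x + y + z)\<^sup>2 \<le> 4 * (w\<^sup>2 + x\<^sup>2 + y\<^sup>2 + z\<^sup>2)" for w x y z :: real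
    proof -
      have "0 \<le> (w - x)\<^sup>2 + (w - y)\<^sup>2 + (w - z)\<^sup>2 + (x - y)\<^sup>2 + (x - z)\<^sup>2 + (y - z)\<^sup>2" by simp
      thus ?thesis by (simp add: power2_eq_square algebra_simps)
    qed
    have a: "a\<^sup>2 \<le> (\<Sum>i<n. (log_ratio n E i)\<^sup>2) / (n * (ln n)\<^sup>2)"
    proof -
      have "(fun_energy n (ln_prod2 E) - 2 * ln n * fun_energy n (adj E))\<^sup>2
          \<le> (2 * real n * sqrt (\<Sum>i<n. (log_ratio n E i)\<^sup>2))\<^sup>2"
        using energy_ln_prod2_adj[OF finE, of n] n by (intro abs_le_square_iff[THEN iffD1]) (simp add: sum_nonneg)
      also have "\<dots> = 4 * (real n)\<^sup>2 * (\<Sum>i<n. (log_ratio n E i)\<^sup>2)"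
        by (simp add: power_mult_distrib sum_nonneg)
      finally have "a\<^sup>2 \<le> 4 * (real n)\<^sup>2 * (\<Sum>i<n. (log_ratio n E i)\<^sup>2) / (2 * ln n * N)\<^sup>2"
        unfolding a_def power_divide by (intro divide_right_mono) auto
      also have "\<dots> = (\<Sum>i<n. (log_ratio n E i)\<^sup>2) / (n * (ln n)\<^sup>2)"
        unfolding power_mult_distrib N(2) using n0 by (simp add: power2_eq_square power3_eq_cube)
      finally show ?thesis .
    qed
    have b: "b\<^sup>2 \<le> 4 / n"
    proof -
      have "(fun_energy n (adj E) - fun_energy n (centered p E))\<^sup>2 \<le> (2 * real n)\<^sup>2"
        using energy_adj_centered[of p E n] E p by (intro abs_le_square_iff[THEN iffD1]) simp
      hence "b\<^sup>2 \<le> (2 * real n)\<^sup>2 / N\<^sup>2"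
        unfolding b_def power_divide by (intro divide_right_mono) auto
      also have "\<dots> = 4 / n" unfolding N(2) using n0 by (simp add: power2_eq_square power3_eq_cube)
      finally show ?thesis .
    qed
    have c: "c\<^sup>2 = (norm (fun_energy n (centered p E) - \<mu>))\<^sup>2 / N\<^sup>2"
      by (simp add: c_def power_divide)
    show ?thesis unfolding split W_def using four[of a b c "energy_error n"] a b c by simp
  qed
  have "graph_mean p n (\<lambda>E. (fun_energy n (ln_prod2 E) / (2 * ln n * N) - \<kappa>)\<^sup>2) \<le> graph_mean p n W"
    by (intro subset_mean_mono pointwise finite_possible_edges)
  also have "\<dots> = 4 * (graph_mean p n (\<lambda>E. \<Sum>i<n. (log_ratio n E i)\<^sup>2) / (n * (ln n)\<^sup>2) + 4 / n
      + graph_mean p n (\<lambda>E. (norm (fun_energy n (centered p E) - \<mu>))\<^sup>2) / N\<^sup>2 + (energy_error n)\<^sup>2)"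
    unfolding W_def by (simp del: Bochner_Integration.integral_sum)
  also have "\<dots> \<le> 4 * ((n * (ln (2 / p))\<^sup>2 + 16 * (ln n)\<^sup>2 / p\<^sup>2) / (n * (ln n)\<^sup>2) + 4 / n
      + ((real n)\<^sup>2 * 2\<^sup>2) / N\<^sup>2 + (energy_error n)\<^sup>2)"
  proof (intro mult_left_mono add_mono divide_right_mono order_refl mean_sum_log_ratio)
    show "graph_mean p n (\<lambda>E. (norm (fun_energy n (centered p E) - \<mu>))\<^sup>2) \<le> (real n)\<^sup>2 * 2\<^sup>2"
      unfolding \<mu>_def
      by (rule bounded_difference_centered[OF p]) (use energy_differ_by_edge in auto)
  qed (use n in auto)
  also have "\<dots> = 4 * ((ln (2 / p))\<^sup>2 / (ln n)\<^sup>2 + 16 / (p\<^sup>2 * n) + 8 / n + (energy_error n)\<^sup>2)"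
    unfolding N(2) using n0 ln0 p by (simp add: add_divide_distrib power2_eq_square power3_eq_cube)
  finally show ?thesis unfolding N_def \<kappa>_def .
qed

lemma energy_error_tendsto_0: "energy_error \<longlonglongrightarrow> 0"
  using mean_energy_centered[OF p] unfolding energy_error_def[abs_def] by (rule LIM_zero)

end

section \<open>The energy of the second multiple Zagreb matrix\<close>

lemma prob_random_subset_le_second_moment:
  assumes "finite S" "\<delta> > 0"
  shows "measure_pmf.prob (random_subset p S) {E. \<bar>Y E\<bar> > \<delta>} \<le> subset_mean p S (\<lambda>E. (Y E)\<^sup>2) / \<delta>\<^sup>2"
proof -
  have "measure_pmf.prob (random_subset p S) {E. \<bar>Y E\<bar> > \<delta>} = subset_mean p S (indicator {E. \<bar>Y E\<bar> > \<delta>})"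
    by simp
  also have "\<dots> \<le> subset_mean p S (\<lambda>E. (Y E)\<^sup>2 / \<delta>\<^sup>2)"
  proof (rule subset_mean_mono[OF assms(1)])
    fix E
    have "\<delta>\<^sup>2 \<le> (Y E)\<^sup>2" if "\<bar>Y E\<bar> > \<delta>"
      using that assms by (intro abs_le_square_iff[THEN iffD1]) simp
    thus "indicator {E. \<bar>Y E\<bar> > \<delta>} E \<le> (Y E)\<^sup>2 / \<delta>\<^sup>2"
      using assms by (auto simp: indicator_def)
  qed
  finally show ?thesis by simp
qed

text \<open>
  Dividing by the constant \<open>\<kappa>\<close>, half of \<open>16 \<surd>(p (1 - p)) / (3 \<pi>)\<close>, turns the mean square
  deviation above into that of the ratio from \<open>1\<close>, and Chebyshev's inequality finishes the proof.
\<close>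

theorem corollary14:
  fixes p :: real
  assumes "0 < p" and "p < 1"
  shows "\<forall>\<epsilon>>0. (\<lambda>n. measure_pmf.prob (gnp n p)
            {E. \<bar>energy (ln_prod2_matrix n E) /
                  (16 / (3 * pi) * sqrt (p * (1 - p)) * real n powr (3 / 2) * ln (real n)) - 1\<bar> > \<epsilon>})
          \<longlonglongrightarrow> 0"
proof (intro allI impI)
  fix \<epsilon> :: real assume \<epsilon>: "\<epsilon> > 0"
  define \<kappa> where "\<kappa> = 8 / (3 * pi) * sqrt (p * (1 - p))"
  have \<kappa>: "\<kappa> > 0" using assms by (simp add: \<kappa>_def)
  define bound where "bound = (\<lambda>n::nat. 4 * ((ln (2 / p))\<^sup>2 / (ln n)\<^sup>2 + 16 / (p\<^sup>2 * n) + 8 / n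
      + (energy_error p n)\<^sup>2) / (\<epsilon> * \<kappa>)\<^sup>2)"
  let ?P = "\<lambda>n. measure_pmf.prob (gnp n p)
            {E. \<bar>energy (ln_prod2_matrix n E) /
                  (16 / (3 * pi) * sqrt (p * (1 - p)) * real n powr (3 / 2) * ln (real n)) - 1\<bar> > \<epsilon>}"
  have "?P n \<le> bound n" if n: "n > 1" for n
  proof -
    define Y where "Y = (\<lambda>E. fun_energy n (ln_prod2 E) / (2 * ln n * (n * sqrt n)) - \<kappa>)"
    have "real n powr (3 / 2) = real n powr (1 + 1 / 2)" by simp
    also have "\<dots> = n * sqrt n" using n unfolding powr_add by (simp add: powr_half_sqrt)
    finally have powr: "real n powr (3 / 2) = n * sqrt n" .
    have "energy (ln_prod2_matrix n E) /
          (16 / (3 * pi) * sqrt (p * (1 - p)) * real n powr (3 / 2) * ln (real n)) - 1 = Y E / \<kappa>" for E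
    proof -
      have "16 / (3 * pi) * sqrt (p * (1 - p)) * real n powr (3 / 2) * ln (real n) = (2 * ln n * (n * sqrt n)) * \<kappa>"
        unfolding powr \<kappa>_def by simp
      thus ?thesis unfolding ln_prod2_matrix_eq energy_eq_fun_energy[OF symmetric_on_ln_prod2] Y_def
        using \<kappa> by (simp only: diff_divide_distrib divide_divide_eq_left) simp
    qed
    hence "?P n = measure_pmf.prob (random_subset p (possible_edges n)) {E. \<bar>Y E / \<kappa>\<bar> > \<epsilon>}"
      by (simp only: gnp_eq_random_subset)
    also have "{E. \<bar>Y E / \<kappa>\<bar> > \<epsilon>} = {E. \<bar>Y E\<bar> > \<epsilon> * \<kappa>}"
      using \<kappa> by (simp add: pos_less_divide_eq)
    also have "measure_pmf.prob (random_subset p (possible_edges n)) \<dots>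
        \<le> graph_mean p n (\<lambda>E. (Y E)\<^sup>2) / (\<epsilon> * \<kappa>)\<^sup>2"
      using \<epsilon> \<kappa> by (intro prob_random_subset_le_second_moment) auto
    also have "\<dots> \<le> bound n"
      unfolding bound_def Y_def \<kappa>_def
      by (intro divide_right_mono mean_square_deviation assms n) simp
    finally show ?thesis .
  qed
  hence "eventually (\<lambda>n. norm (?P n) \<le> bound n) sequentially"
    by (auto intro!: eventually_sequentiallyI[of 2])
  moreover have "bound \<longlonglongrightarrow> 0"
  proof -
    have "(\<lambda>n::nat. (ln (2 / p))\<^sup>2 / (ln n)\<^sup>2 + 16 / (p\<^sup>2 * n) + 8 / n) \<longlonglongrightarrow> 0"
      using assms by real_asymp
    hence "(\<lambda>n. 4 * ((ln (2 / p))\<^sup>2 / (ln n)\<^sup>2 + 16 / (p\<^sup>2 * n) + 8 / n + (energy_error p n)\<^sup>2) / (\<epsilon> * \<kappa>)\<^sup>2)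
        \<longlonglongrightarrow> 4 * (0 + 0\<^sup>2) / (\<epsilon> * \<kappa>)\<^sup>2"
      using \<epsilon> \<kappa> by (intro tendsto_intros energy_error_tendsto_0 assms) auto
    thus ?thesis by (simp add: bound_def)
  qed
  ultimately show "?P \<longlonglongrightarrow> 0" by (rule Lim_null_comparison)
qed

end
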